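(* Let $\gamma>0$, $\tau<0$. Let $F \in \mathcal{F}(\gamma,\tau)$ with $F(0)=0$, with associated functions $\delta$ and $a$ (defined in the context), and let $X_1,\ldots,X_n$ be independent random variables with common distribution function $F$. Let $k = k_n \in \{1,\ldots,n-1\}$ be an intermediate integer sequence, that is, $k\to\infty$ and $k/n\to 0$ as $n\to\infty$, satisfying $\sqrt{k}\,a(n/k) \to \lambda \in \mathbb{R}$ as $n\to\infty$. Let $x_n \to \infty$ and let $p_n = \overline{F}(x_n)$ be such that $$n p_n/k \to 0 \quad\text{and}\quad \log(n p_n)/\sqrt{k} \to 0, \qquad n\to\infty.$$ Let $\hat\gamma_n$, $\hat\delta_n$, $\hat\tau_n$ be estimator sequences such that, with $\delta_n = \delta(X_{n-k:n})$, $\Gamma_{k,n} = \sqrt{k}(\hat\gamma_n-\gamma)$, $\Delta_{k,n} = \sqrt{k}(\hat\delta_n - \delta_n)$ and $Z_{k,n} = \sqrt{k}\{n\overline{F}(X_{n-k:n})/k-1\}$, $$\hat\tau_n = \tau + o_p(1) \quad\text{and}\quad (\Gamma_{k,n},\Delta_{k,n},Z_{k,n}) \rightsquigarrow (\Gamma,\Delta,Z), \qquad n\to\infty,$$ for some trivariate random vector $(\Gamma,\Delta,Z)$. Define the tail probability estimator $$\hat p_{k,n} = \frac{k}{n}\,\overline{G}_{\hat\gamma_n,\hat\delta_n,\hat\tau_n}(x_n/X_{n-k:n}).$$ Then $$\frac{\sqrt{k}}{\log\{k/(np_n)\}}\left(\frac{\hat p_{k,n}}{p_n} - 1\right) \rightsquigarrow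 \gamma^{-1}\Gamma, \qquad n\to\infty.$$
   Context: The arrow $\rightsquigarrow$ denotes convergence in distribution, and $o_p(1)$ denotes convergence to zero in probability. For a distribution function $F$ write $\overline{F} = 1-F$. Order statistics of the sample are denoted $X_{1:n}\leq\cdots\leq X_{n:n}$. A positive measurable function $f$ defined in a right neighborhood of infinity is regularly varying with index $\beta \in \mathbb{R}$, written $f \in \mathcal{R}_\beta$, if $\lim_{u\to\infty} f(ux)/f(u) = x^\beta$ for all $x \in (0,\infty)$. The class $\mathcal{F}(\gamma,\tau)$ ($\gamma>0$, $\tau<0$): a distribution function $F$ belongs to $\mathcal{F}(\gamma,\tau)$ if $x^{1/\gamma}\overline{F}(x) \to C \in (0,\infty)$ as $x \to \infty$ and if the function $\delta$ defined via $\overline{F}(x) = C x^{-1/\gamma}\{1 + \gamma^{-1}\delta(x)\}$ is eventually nonzero and of constant sign and satisfies $|\delta| \in \mathcal{R}_\tau$. Tail quantile function: $U(y) = Q(1-1/y)$ for $y \in (1,\infty)$, where $Q(p) = \inf\{x \in \mathbb{R} : F(x) \geq p\}$, $p \in (0,1)$. The function $a$ is defined implicitly by $U(y) = C^\gamma y^\gamma\{1 + a(y)\}$, with $C = \lim_{x\to\infty} x^{1/\gamma}\overline{F}(x)$. Extended Pareto Distribution (EPD): for parameters $\tau < 0 < \gamma$ and $\delta > \max(-1, 1/\tau)$, its distribution function is $G_{\gamma,\delta,\tau}(y) = 1 - \{y(1+\delta-\delta y^\tau)\}^{-1/\gamma}$ for $y > 1$ and $G_{\gamma,\delta,\tau}(y)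 = 0$ for $y \leq 1$; $\overline{G}_{\gamma,\delta,\tau} = 1 - G_{\gamma,\delta,\tau}$. The estimator $\hat p_{k,n}$ may be given arbitrary values on events where the estimated parameters fall outside the EPD parameter range. *)

theory Defs
  imports "HOL-Probability.Probability"
begin

definition distribution_function :: "(real \<Rightarrow> real) \<Rightarrow> bool" where
  "distribution_function F \<longleftrightarrow> (\<exists>\<mu>. real_distribution \<mu> \<and> F = cdf \<mu>)"

definition regularly_varying :: "(real \<Rightarrow> real) \<Rightarrow> real \<Rightarrow> bool" where
  "regularly_varying f \<beta> \<longleftrightarrow>
     (\<exists>A. f \<in> borel_measurable (restrict_space borel {A<..}) \<and> (\<forall>x>A. f x > 0)) \<and>
     (\<forall>x>0. ((\<lambda>u. f (u * x) / f u) \<longlongrightarrow> x powr \<beta>) at_top)"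

definition tail_const :: "real \<Rightarrow> (real \<Rightarrow> real) \<Rightarrow> real" where
  "tail_const \<gamma> F = Lim at_top (\<lambda>x. x powr (1 / \<gamma>) * (1 - F x))"

(* Obtained by solving 1 - F x = C * x powr (-1/\<gamma>) * (1 + \<delta> x / \<gamma>) for \<delta> x;
   see tail_eq_tail_delta. *)
definition tail_delta :: "real \<Rightarrow> (real \<Rightarrow> real) \<Rightarrow> real \<Rightarrow> real" where
  "tail_delta \<gamma> F x = \<gamma> * (x powr (1 / \<gamma>) * (1 - F x) / tail_const \<gamma> F - 1)"

definition tail_class :: "real \<Rightarrow> real \<Rightarrow> (real \<Rightarrow> real) set" where
  "tail_class \<gamma> \<tau> = {F. distribution_function F \<and>
     (\<exists>C>0. ((\<lambda>x. x powr (1 / \<gamma>) * (1 - F x)) \<longlongrightarrow> C) at_top) \<and>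
     ((\<forall>\<^sub>F x in at_top. tail_delta \<gamma> F x > 0) \<or> (\<forall>\<^sub>F x in at_top. tail_delta \<gamma> F x < 0)) \<and>
     regularly_varying (\<lambda>x. \<bar>tail_delta \<gamma> F x\<bar>) \<tau>}"

definition quantile :: "(real \<Rightarrow> real) \<Rightarrow> real \<Rightarrow> real" where
  "quantile F p = Inf {x. F x \<ge> p}"

definition tail_quantile :: "(real \<Rightarrow> real) \<Rightarrow> real \<Rightarrow> real" where
  "tail_quantile F y = quantile F (1 - 1 / y)"

(* Obtained by solving U y = C powr \<gamma> * y powr \<gamma> * (1 + a y) for a y, where U is the
   tail quantile function; see tail_quantile_eq_tail_a. *)
definition tail_a :: "real \<Rightarrow> (real \<Rightarrow> real) \<Rightarrow> real \<Rightarrow> real" where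
  "tail_a \<gamma> F y = tail_quantile F y / (tail_const \<gamma> F powr \<gamma> * y powr \<gamma>) - 1"

lemma tail_const_eqI:
  assumes "((\<lambda>x. x powr (1 / \<gamma>) * (1 - F x)) \<longlongrightarrow> C) at_top"
  shows "tail_const \<gamma> F = C"
  unfolding tail_const_def using assms by (intro tendsto_Lim) auto

lemma tail_const_pos: "F \<in> tail_class \<gamma> \<tau> \<Longrightarrow> tail_const \<gamma> F > 0"
  by (auto simp: tail_class_def dest: tail_const_eqI)

lemma tail_eq_tail_delta:
  assumes "F \<in> tail_class \<gamma> \<tau>" "\<gamma> > 0" "x > 0"
  shows "1 - F x = tail_const \<gamma> F * x powr (- 1 / \<gamma>) * (1 + tail_delta \<gamma> F x / \<gamma>)"
  using assms tail_const_pos[OF assms(1)] by (simp add: tail_delta_def powr_minus field_simps)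

lemma tail_quantile_eq_tail_a:
  assumes "F \<in> tail_class \<gamma> \<tau>" "y > 0"
  shows "tail_quantile F y = tail_const \<gamma> F powr \<gamma> * y powr \<gamma> * (1 + tail_a \<gamma> F y)"
  using assms tail_const_pos[OF assms(1)] by (simp add: tail_a_def)

definition epd_params :: "real \<Rightarrow> real \<Rightarrow> real \<Rightarrow> bool" where
  "epd_params \<gamma> \<delta> \<tau> \<longleftrightarrow> \<tau> < 0 \<and> 0 < \<gamma> \<and> \<delta> > max (- 1) (1 / \<tau>)"

definition epd_cdf :: "real \<Rightarrow> real \<Rightarrow> real \<Rightarrow> real \<Rightarrow> real" where
  "epd_cdf \<gamma> \<delta> \<tau> y =
     (if y > 1 then 1 - (y * (1 + \<delta> - \<delta> * y powr \<tau>)) powr (- 1 / \<gamma>) else 0)"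

(* The sample of size n is x 0, ..., x (n - 1); the rank j ranges over 1, ..., n,
   with j = 1 for the minimum. *)
definition order_statistic :: "(nat \<Rightarrow> real) \<Rightarrow> nat \<Rightarrow> nat \<Rightarrow> real" where
  "order_statistic x j n = sort (map x [0..<n]) ! (j - 1)"

definition conv_zero_in_prob :: "'a measure \<Rightarrow> (nat \<Rightarrow> 'a \<Rightarrow> real) \<Rightarrow> bool" where
  "conv_zero_in_prob M Y \<longleftrightarrow>
     (\<forall>\<epsilon>>0. (\<lambda>n. measure M {\<omega> \<in> space M. \<bar>Y n \<omega>\<bar> > \<epsilon>}) \<longlonglongrightarrow> 0)"

(* The library's weak_conv_m covers real-valued variables only. *)
definition conv_in_distr ::
  "'a measure \<Rightarrow> (nat \<Rightarrow> 'a \<Rightarrow> 'c::topological_space) \<Rightarrow> 'b measure \<Rightarrow> ('b \<Rightarrow> 'c) \<Rightarrow> bool" where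
  "conv_in_distr M Y N Y0 \<longleftrightarrow>
     (\<forall>f :: 'c \<Rightarrow> real. continuous_on UNIV f \<and> bounded (range f) \<longrightarrow>
        (\<lambda>n. \<integral>\<omega>. f (Y n \<omega>) \<partial>M) \<longlonglongrightarrow> (\<integral>\<omega>. f (Y0 \<omega>) \<partial>N))"

lemma conv_in_distr_iff_weak_conv_m:
  fixes Y :: "nat \<Rightarrow> 'a \<Rightarrow> real" and Y0 :: "'b \<Rightarrow> real"
  assumes M: "prob_space M" and N: "prob_space N"
    and Y [measurable]: "\<And>n. Y n \<in> borel_measurable M"
    and Y0 [measurable]: "Y0 \<in> borel_measurable N"
  shows "conv_in_distr M Y N Y0 \<longleftrightarrow> weak_conv_m (\<lambda>n. distr M borel (Y n)) (distr N borel Y0)"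
proof -
  have rd: "real_distribution (distr M borel (Y n))" "real_distribution (distr N borel Y0)" for n
    using prob_space.real_distribution_distr[OF M] prob_space.real_distribution_distr[OF N] by auto
  have int: "(\<integral>x. f x \<partial>distr M borel (Y n)) = (\<integral>\<omega>. f (Y n \<omega>) \<partial>M)"
    "(\<integral>x. f x \<partial>distr N borel Y0) = (\<integral>\<omega>. f (Y0 \<omega>) \<partial>N)"
    if "continuous_on UNIV f" for f :: "real \<Rightarrow> real" and n
    using that by (auto intro!: integral_distr borel_measurable_continuous_onI)
  show ?thesis
  proof
    assume *: "conv_in_distr M Y N Y0"
    show "weak_conv_m (\<lambda>n. distr M borel (Y n)) (distr N borel Y0)"
    proof (rule integral_bdd_continuous_conv_imp_weak_conv[OF rd])
      fix f :: "real \<Rightarrow> real"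
      assume f: "\<And>x. isCont f x" "\<And>x. \<bar>f x\<bar> \<le> 1"
      then have c: "continuous_on UNIV f" by (simp add: continuous_at_imp_continuous_on)
      have "bounded (range f)" using f(2) by (auto simp: bounded_iff)
      then show "(\<lambda>n. \<integral>x. f x \<partial>distr M borel (Y n)) \<longlonglongrightarrow> (\<integral>x. f x \<partial>distr N borel Y0)"
        using * c by (simp add: int conv_in_distr_def)
    qed
  next
    assume *: "weak_conv_m (\<lambda>n. distr M borel (Y n)) (distr N borel Y0)"
    show "conv_in_distr M Y N Y0"
      unfolding conv_in_distr_def
    proof (intro allI impI)
      fix f :: "real \<Rightarrow> real"
      assume f: "continuous_on UNIV f \<and> bounded (range f)"
      then obtain B where B: "\<And>x. norm (f x) \<le> B" by (auto simp: bounded_iff)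
      have "(\<lambda>n. \<integral>x. f x \<partial>distr M borel (Y n)) \<longlonglongrightarrow> (\<integral>x. f x \<partial>distr N borel Y0)"
        by (rule weak_conv_imp_integral_bdd_continuous_conv[OF rd * _ B])
          (use f in \<open>auto simp: continuous_on_eq_continuous_at\<close>)
      then show "(\<lambda>n. \<integral>\<omega>. f (Y n \<omega>) \<partial>M) \<longlonglongrightarrow> (\<integral>\<omega>. f (Y0 \<omega>) \<partial>N)"
        using f by (simp add: int)
    qed
  qed
qed

end

theory Submission
  imports Defs
begin

text \<open>
  Write \<open>s = sqrt k\<close>, \<open>m = n / k\<close>, \<open>l = ln (1 / (m p))\<close> and \<open>Y\<close> for the order statistic
  \<open>X_{n-k:n}\<close>. The proof is a logarithmic expansion of \<open>phat / p\<close>. Both \<open>p = 1 - F x\<close> and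
  \<open>1 - F Y\<close> have the form \<open>C v powr (- 1 / \<gamma>) (1 + \<delta> v / \<gamma>)\<close>; dividing one by the other removes
  \<open>C\<close> and expresses \<open>ln (x / Y)\<close> as
  \<open>\<gamma> (l + ln (m (1 - F Y)) + ln (1 + \<delta> x / \<gamma>) - ln (1 + \<delta> Y / \<gamma>))\<close>. Inserting this into the
  extended Pareto tail gives \<open>ln (phat / p) = l - (\<gamma> l + u) / \<gamma>hat\<close>, where \<open>u\<close> collects four
  logarithms, each of order \<open>1 / s\<close>. Multiplied by \<open>s / l\<close>, the main part
  \<open>l (1 - \<gamma> / \<gamma>hat)\<close> becomes \<open>s (\<gamma>hat - \<gamma>) / \<gamma>hat\<close>, while the contribution of \<open>u\<close> is of order
  \<open>1 / l\<close> and vanishes. Passing from \<open>ln (phat / p)\<close> to \<open>phat / p - 1\<close> costs nothing because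
  \<open>l / s\<close> tends to 0. Hence the normalised error differs from \<open>s (\<gamma>hat - \<gamma>) / \<gamma>\<close> by a term that
  tends to 0 in probability (\<open>relative_error_expansion\<close>, \<open>epd_relative_error_expansion\<close>), and
  Slutsky's lemma finishes the proof.

  The real work is to show that \<open>s \<delta> Y\<close> and \<open>s \<delta> x\<close> stay bounded. The hypothesis on \<open>tail_a\<close> only
  controls \<open>\<delta>\<close> at points near the tail quantile \<open>U (n / k)\<close>. These points lie below \<open>Y\<close> (with high
  probability) and below \<open>x\<close> once they are divided by 2 (\<open>tail_class_reference_points\<close>), and a
  regularly varying function of negative index is bounded on \<open>[w, \<infinity>)\<close> by a constant multiple of
  its value at \<open>w\<close> (\<open>regularly_varying_quasi_decreasing\<close>), so the control passes to \<open>Y\<close> and \<open>x\<close>.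

  All probabilistic estimates are reduced to deterministic ones. By tightness, for each
  \<open>\<eta> > 0\<close> there are events \<open>E n\<close> of probability at least \<open>1 - \<eta>\<close> for large \<open>n\<close> on which the scaled
  errors of the estimators are bounded by one constant. The filter \<open>uniformly_along E\<close> on pairs
  \<open>(n, \<omega>)\<close> describes convergence that is uniform over \<open>\<omega> \<in> E n\<close>, and the expansion is an ordinary
  limit along this filter.
\<close>

section \<open>Regularly varying functions of negative index\<close>

text \<open>
  The boundedness half of the uniform convergence theorem for regularly varying functions. Pointwise
  convergence gives convergence in measure, so for large \<open>t\<close> the increment \<open>h (t + s) - h t\<close> is
  within 1 of \<open>c s\<close> for all \<open>s\<close> in \<open>[0, 2]\<close> outside a set of measure below \<open>1 / 2\<close>. Two such
  exceptional sets, one based at \<open>t\<close> and one at \<open>t + r\<close>, cannot cover \<open>[1, 2]\<close>; a point that both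
  miss links \<open>h t\<close> with \<open>h (t + r)\<close>.
\<close>

lemma additive_increments_bounded:
  fixes h :: "real \<Rightarrow> real"
  assumes h [measurable]: "h \<in> borel_measurable borel"
    and lim: "\<And>s. ((\<lambda>t. h (t + s) - h t) \<longlongrightarrow> c * s) at_top"
  shows "\<exists>t0. \<forall>t\<ge>t0. \<forall>s\<in>{0..1}. \<bar>h (t + s) - h t\<bar> \<le> 2 + \<bar>c\<bar>"
proof -
  define S where "S t = {s\<in>{0..2}. \<bar>h (t + s) - h t - c * s\<bar> \<ge> 1}" for t
  have S [measurable]: "S t \<in> sets borel" for t
    unfolding S_def by measurable
  have S_sub: "S t \<subseteq> {0..2}" for t
    by (auto simp: S_def)
  have S_finite: "emeasure lborel (S t) < \<infinity>" for t
    by (rule order.strict_trans1[OF emeasure_mono[OF S_sub[of t], of lborel]]) simp_all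
  have "((\<lambda>t. \<integral>s. indicator (S t) s \<partial>lborel) \<longlongrightarrow> (\<integral>s. 0 \<partial>(lborel :: real measure) :: real)) at_top"
  proof (rule integral_dominated_convergence_at_top[where w = "indicator {0..2}"])
    show "AE s in lborel. ((\<lambda>t. indicator (S t) s :: real) \<longlongrightarrow> 0) at_top"
    proof (rule AE_I2)
      fix s :: real
      have "((\<lambda>t. h (t + s) - h t - c * s) \<longlongrightarrow> c * s - c * s) at_top"
        by (intro tendsto_diff lim tendsto_const)
      then have "\<forall>\<^sub>F t in at_top. \<bar>h (t + s) - h t - c * s\<bar> < 1"
        by (auto dest: tendstoD[of _ _ _ 1] simp: dist_real_def)
      then have "\<forall>\<^sub>F t in at_top. indicator (S t) s = (0::real)"
        by eventually_elim (auto simp: S_def)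
      then show "((\<lambda>t. indicator (S t) s :: real) \<longlongrightarrow> 0) at_top"
        by (rule tendsto_eventually)
    qed
  qed (auto simp: S_def intro!: always_eventually AE_I2 split: split_indicator)
  then have "((\<lambda>t. measure lborel (S t)) \<longlongrightarrow> 0) at_top"
    by simp
  then have "\<forall>\<^sub>F t in at_top. measure lborel (S t) < 1 / 2"
    by (rule order_tendstoD) simp
  then obtain t0 where t0: "\<And>t. t \<ge> t0 \<Longrightarrow> measure lborel (S t) < 1 / 2"
    by (auto simp: eventually_at_top_linorder)
  have "\<bar>h (t + r) - h t\<bar> \<le> 2 + \<bar>c\<bar>" if t: "t \<ge> t0" and r: "0 \<le> r" "r \<le> 1" for t r
  proof -
    \<comment> \<open>The exceptional set of the base point \<open>t + r\<close>, in the coordinates of the base point \<open>t\<close>.\<close>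
    define S' where "S' = (\<lambda>s. r + s) ` S (t + r)"
    have S'_eq: "S' = (\<lambda>s. s - r) -` S (t + r) \<inter> space borel"
      unfolding S'_def by (auto intro!: image_eqI[where x = "_ - r"])
    have [measurable]: "S' \<in> sets borel"
      unfolding S'_eq by measurable
    have m': "measure lborel S' = measure lborel (S (t + r))"
      using measure_translation[of r "S (t + r)"] \<open>S' \<in> sets borel\<close> S[of "t + r"]
      by (simp add: S'_def measure_completion)
    have S'_sub: "S' \<subseteq> {0..3}"
      using S_sub[of "t + r"] r by (force simp: S'_def)
    have S'_finite: "emeasure lborel S' < \<infinity>"
      by (rule order.strict_trans1[OF emeasure_mono[OF S'_sub, of lborel]]) simp_all
    have "\<not> {1..2} \<subseteq> S t \<union> S'"
    proof
      assume "{1..2} \<subseteq> S t \<union> S'"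
      then have "measure lborel {1..2::real} \<le> measure lborel (S t \<union> S')"
        using S_finite[of t] S'_finite
        by (intro measure_mono_fmeasurable fmeasurable.Un fmeasurableI) auto
      also have "\<dots> \<le> measure lborel (S t) + measure lborel S'"
        by (rule measure_Un_le) auto
      also have "\<dots> < 1 / 2 + 1 / 2"
        unfolding m' using t0[of t] t0[of "t + r"] t r by auto
      finally show False by simp
    qed
    then obtain s where s: "1 \<le> s" "s \<le> 2" "s \<notin> S t" "s \<notin> S'"
      by (auto simp: subset_eq)
    have "s - r \<notin> S (t + r)"
      using s(4) by (force simp: S'_def)
    then have "\<bar>h (t + s) - h (t + r) - c * (s - r)\<bar> < 1"
      using s r by (auto simp: S_def)
    moreover have "\<bar>h (t + s) - h t - c * s\<bar> < 1"
      using s by (auto simp: S_def)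
    moreover have "\<bar>c * r\<bar> \<le> \<bar>c\<bar>"
      using r by (simp add: abs_mult mult_left_le)
    ultimately show ?thesis
      by (simp add: algebra_simps)
  qed
  then show ?thesis by (meson atLeastAtMost_iff)
qed

text \<open>
  A weak form of Potter's bounds. In logarithmic coordinates regular variation is convergence of
  additive increments. A unit step eventually decreases the function, since the index is negative,
  and the remaining fractional step costs at most a bounded amount.
\<close>

lemma regularly_varying_quasi_decreasing:
  assumes f: "regularly_varying f \<beta>" and \<beta>: "\<beta> < 0"
  shows "\<exists>K x0. \<forall>u\<ge>x0. \<forall>x\<ge>u. f x \<le> K * f u"
proof -
  obtain A where meas: "f \<in> borel_measurable (restrict_space borel {A<..})"
    and pos: "\<And>x. x > A \<Longrightarrow> f x > 0"
    and lim: "\<And>x. x > 0 \<Longrightarrow> ((\<lambda>u. f (u * x) / f u) \<longlongrightarrow> x powr \<beta>) at_top"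
    using f by (auto simp: regularly_varying_def)
  \<comment> \<open>Changing \<open>f\<close> below \<open>A\<close> makes the logarithm below measurable on the whole line.\<close>
  define f1 where "f1 x = (if x \<in> {A<..} then f x else 1)" for x
  have [measurable]: "f1 \<in> borel_measurable borel"
    using measurable_restrict_space_iff[of "{A<..}" borel 1 borel f] meas
    by (simp add: f1_def[abs_def])
  have f1_pos: "f1 x > 0" for x
    using pos by (simp add: f1_def)
  define h where "h t = ln (f1 (exp t))" for t
  have h_meas: "h \<in> borel_measurable borel"
    unfolding h_def[abs_def] by measurable
  have h_lim: "((\<lambda>t. h (t + s) - h t) \<longlongrightarrow> \<beta> * s) at_top" for s
  proof -
    have ln_lim: "((\<lambda>t. ln (f (exp t * exp s) / f (exp t))) \<longlongrightarrow> ln (exp s powr \<beta>)) at_top"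
      by (intro tendsto_ln filterlim_compose[OF lim exp_at_top]) auto
    have "\<forall>\<^sub>F t in at_top. exp (r + t) > A" for r
      using filterlim_compose[OF exp_at_top filterlim_tendsto_add_at_top[OF tendsto_const filterlim_ident], of r]
      by (auto simp: filterlim_at_top_dense)
    from this[of 0] this[of s]
    have "\<forall>\<^sub>F t in at_top. exp t > A \<and> exp (s + t) > A"
      by eventually_elim simp
    then have "\<forall>\<^sub>F t in at_top. ln (f (exp t * exp s) / f (exp t)) = h (t + s) - h t"
      by eventually_elim (auto simp: h_def f1_def exp_add[symmetric] ln_div add.commute dest!: pos)
    then show ?thesis
      using Lim_transform_eventually[OF ln_lim] by simp
  qed
  obtain t0 where t0: "\<And>t s. t \<ge> t0 \<Longrightarrow> 0 \<le> s \<Longrightarrow> s \<le> 1 \<Longrightarrow> \<bar>h (t + s) - h t\<bar> \<le> 2 + \<bar>\<beta>\<bar>"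
    using additive_increments_bounded[OF h_meas h_lim] by (meson atLeastAtMost_iff)
  have "\<forall>\<^sub>F t in at_top. h (t + 1) - h t < 0"
    by (rule order_tendstoD(2)[OF h_lim]) (use \<beta> in simp)
  then obtain t1 where t1: "\<And>t. t \<ge> t1 \<Longrightarrow> h (t + 1) - h t < 0"
    by (auto simp: eventually_at_top_linorder)
  define T where "T = max t0 t1"
  have step: "h (t + real m) \<le> h t" if "t \<ge> T" for t m
  proof (induction m)
    case (Suc m)
    have "h (t + real m + 1) - h (t + real m) < 0"
      using that by (intro t1) (auto simp: T_def)
    with Suc show ?case by (simp add: algebra_simps)
  qed simp
  have h_le: "h t' \<le> h t + (2 + \<bar>\<beta>\<bar>)" if "t \<ge> T" "t' \<ge> t" for t t'
  proof -
    define m where "m = nat \<lfloor>t' - t\<rfloor>"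
    define s where "s = t' - t - real m"
    have s: "0 \<le> s" "s \<le> 1"
      using that unfolding s_def m_def by linarith+
    have "h t' = h (t + real m + s)"
      by (simp add: s_def)
    also have "\<dots> \<le> h (t + real m) + (2 + \<bar>\<beta>\<bar>)"
      using t0[of "t + real m" s] s that by (auto simp: T_def)
    also have "\<dots> \<le> h t + (2 + \<bar>\<beta>\<bar>)"
      using step[of t m] that by simp
    finally show ?thesis .
  qed
  have "f x \<le> exp (2 + \<bar>\<beta>\<bar>) * f u" if u: "u \<ge> max (exp T) (\<bar>A\<bar> + 1)" and x: "x \<ge> u" for u x
  proof -
    have u0: "u > 0" "x > 0" "u > A" "x > A"
      using u x by auto
    have "ln u \<ge> T"
      using u u0 by (simp add: ln_ge_iff)
    then have "h (ln x) \<le> h (ln u) + (2 + \<bar>\<beta>\<bar>)"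
      using x u0 by (intro h_le) auto
    then have "ln (f x) \<le> ln (f u) + (2 + \<bar>\<beta>\<bar>)"
      using u0 by (simp add: h_def f1_def)
    then have "exp (ln (f x)) \<le> exp (ln (f u) + (2 + \<bar>\<beta>\<bar>))"
      by simp
    then show ?thesis
      using u0 pos by (simp add: exp_add mult.commute)
  qed
  then show ?thesis by blast
qed

section \<open>Linearization at a growing scale\<close>

text \<open>
  Bounds of the form \<open>\<bar>s i * v i\<bar> \<le> B\<close> with \<open>s\<close> tending to infinity play the role of \<open>v = O(1 / s)\<close>
  with an explicit constant.
\<close>

lemma tendsto_0_of_scaled_bounded:
  fixes s v :: "'i \<Rightarrow> real"
  assumes s: "filterlim s at_top L" and b: "\<forall>\<^sub>F i in L. \<bar>s i * v i\<bar> \<le> B"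
  shows "(v \<longlongrightarrow> 0) L"
proof (rule Lim_null_comparison)
  show "\<forall>\<^sub>F i in L. norm (v i) \<le> B * inverse (s i)"
    using b filterlim_at_top_dense[THEN iffD1, OF s, rule_format, of 0]
    by eventually_elim (simp add: abs_mult field_simps)
  show "((\<lambda>i. B * inverse (s i)) \<longlongrightarrow> 0) L"
    using tendsto_mult_right_zero[OF tendsto_inverse_0_at_top[OF s]] .
qed

text \<open>
  The delta method: a remainder \<open>o(v)\<close> is still negligible after multiplication by a scale \<open>s\<close> for
  which \<open>s * v\<close> stays bounded.
\<close>

lemma scaled_linearization:
  fixes s v :: "'i \<Rightarrow> real" and g :: "real \<Rightarrow> real"
  assumes g: "(g has_field_derivative d) (at 0)"
    and v: "(v \<longlongrightarrow> 0) L" and b: "\<forall>\<^sub>F i in L. \<bar>s i * v i\<bar> \<le> B"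
  shows "((\<lambda>i. s i * (g (v i) - g 0 - d * v i)) \<longlongrightarrow> 0) L"
proof -
  obtain G where G: "\<And>z. g z - g 0 = G z * z" "isCont G 0" "G 0 = d"
    using g by (auto simp: CARAT_DERIV)
  have "((\<lambda>i. G (v i)) \<longlongrightarrow> d) L"
    using isCont_tendsto_compose[OF G(2) v] G(3) by simp
  then have lim: "((\<lambda>i. B * \<bar>G (v i) - d\<bar>) \<longlongrightarrow> 0) L"
    by (intro tendsto_mult_right_zero tendsto_rabs_zero) (simp add: LIM_zero_iff)
  show ?thesis
  proof (rule Lim_null_comparison[OF _ lim])
    show "\<forall>\<^sub>F i in L. norm (s i * (g (v i) - g 0 - d * v i)) \<le> B * \<bar>G (v i) - d\<bar>"
      using b
    proof eventually_elim
      case (elim i)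
      have "s i * (g (v i) - g 0 - d * v i) = (s i * v i) * (G (v i) - d)"
        by (simp add: G(1) algebra_simps)
      then have "norm (s i * (g (v i) - g 0 - d * v i)) = \<bar>s i * v i\<bar> * \<bar>G (v i) - d\<bar>"
        by (simp only: real_norm_def abs_mult)
      then show ?case
        using mult_right_mono[OF elim, of "\<bar>G (v i) - d\<bar>"] by simp
    qed
  qed
qed

lemma scaled_ln_bounded:
  fixes s v :: "'i \<Rightarrow> real"
  assumes s: "filterlim s at_top L" and b: "\<forall>\<^sub>F i in L. \<bar>s i * v i\<bar> \<le> B"
  shows "\<forall>\<^sub>F i in L. \<bar>s i * ln (1 + v i)\<bar> \<le> B + 1"
proof -
  have "((\<lambda>x. ln (1 + x)) has_field_derivative 1) (at (0::real))"
    by (auto intro!: derivative_eq_intros)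
  from scaled_linearization[OF this tendsto_0_of_scaled_bounded[OF s b] b]
  have "((\<lambda>i. s i * (ln (1 + v i) - v i)) \<longlongrightarrow> 0) L"
    by simp
  then have "\<forall>\<^sub>F i in L. \<bar>s i * (ln (1 + v i) - v i)\<bar> < 1"
    by (auto dest: tendstoD[of _ _ _ 1] simp: dist_real_def)
  with b show ?thesis
    by eventually_elim (simp add: algebra_simps)
qed

text \<open>
  The decisive cancellation. With \<open>e = l - (\<gamma> l + u) / g\<close>,
  \<open>s e / l - s (g - \<gamma>) / \<gamma> = s (g - \<gamma>) (1 / g - 1 / \<gamma>) - s u / (g l)\<close>,
  where the first term is bounded times null and the second is bounded over \<open>l\<close>. Consequently
  \<open>s e / l\<close> is bounded, so \<open>e\<close> is \<open>O(l / s)\<close> and tends to 0, and \<open>exp e - 1\<close> may be replaced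
  by \<open>e\<close>.
\<close>

lemma relative_error_expansion:
  fixes s l g u q :: "'i \<Rightarrow> real"
  assumes s: "filterlim s at_top L" and l: "filterlim l at_top L"
    and l_s: "((\<lambda>i. l i / s i) \<longlongrightarrow> 0) L"
    and \<gamma>: "\<gamma> > 0" and g: "\<forall>\<^sub>F i in L. \<bar>s i * (g i - \<gamma>)\<bar> \<le> B"
    and u: "\<forall>\<^sub>F i in L. \<bar>s i * u i\<bar> \<le> B'"
    and q: "\<forall>\<^sub>F i in L. q i = exp (l i - (\<gamma> * l i + u i) / g i)"
  shows "((\<lambda>i. s i / l i * (q i - 1) - s i * (g i - \<gamma>) / \<gamma>) \<longlongrightarrow> 0) L"
proof -
  define e where "e i = l i - (\<gamma> * l i + u i) / g i" for i
  have "((\<lambda>i. g i - \<gamma>) \<longlongrightarrow> 0) L"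
    by (rule tendsto_0_of_scaled_bounded[OF s g])
  then have g_lim: "(g \<longlongrightarrow> \<gamma>) L"
    by (simp add: LIM_zero_iff)
  have s_pos: "\<forall>\<^sub>F i in L. s i > 0" and l_pos: "\<forall>\<^sub>F i in L. l i > 0"
    using s l by (auto simp: filterlim_at_top_dense)
  have g_pos: "\<forall>\<^sub>F i in L. g i > 0"
    using g_lim \<gamma> by (rule order_tendstoD)
  have inv_lim: "((\<lambda>i. inverse (g i) - inverse \<gamma>) \<longlongrightarrow> 0) L"
    using tendsto_inverse[OF g_lim] \<gamma> by (simp add: LIM_zero_iff)
  have "((\<lambda>i. s i / l i * e i - s i * (g i - \<gamma>) / \<gamma>) \<longlongrightarrow> 0) L"
  proof (rule Lim_null_comparison)
    show "((\<lambda>i. B * \<bar>inverse (g i) - inverse \<gamma>\<bar> + B' * \<bar>inverse (g i)\<bar> * inverse (l i)) \<longlongrightarrow> 0) L"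
      using tendsto_add[OF tendsto_mult_right_zero[OF tendsto_rabs_zero[OF inv_lim], of B]
        tendsto_mult[OF tendsto_mult[OF tendsto_const[of B'] tendsto_rabs[OF tendsto_inverse[OF g_lim]]]
          tendsto_inverse_0_at_top[OF l]]] \<gamma>
      by simp
    show "\<forall>\<^sub>F i in L. norm (s i / l i * e i - s i * (g i - \<gamma>) / \<gamma>)
        \<le> B * \<bar>inverse (g i) - inverse \<gamma>\<bar> + B' * \<bar>inverse (g i)\<bar> * inverse (l i)"
      using g u g_pos l_pos
    proof eventually_elim
      case (elim i)
      have "s i / l i * e i - s i * (g i - \<gamma>) / \<gamma> =
          s i * (g i - \<gamma>) * (inverse (g i) - inverse \<gamma>) - s i * u i * inverse (g i) * inverse (l i)"
        using elim \<gamma> by (simp add: e_def field_simps)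
      also have "norm \<dots> \<le> \<bar>s i * (g i - \<gamma>)\<bar> * \<bar>inverse (g i) - inverse \<gamma>\<bar>
          + \<bar>s i * u i\<bar> * \<bar>inverse (g i)\<bar> * \<bar>inverse (l i)\<bar>"
        by (metis abs_mult abs_triangle_ineq4 real_norm_def)
      also have "\<dots> \<le> B * \<bar>inverse (g i) - inverse \<gamma>\<bar> + B' * \<bar>inverse (g i)\<bar> * \<bar>inverse (l i)\<bar>"
        using elim by (intro add_mono mult_right_mono) auto
      finally show ?case using elim by simp
    qed
  qed
  note main = this
  have bnd: "\<forall>\<^sub>F i in L. \<bar>s i / l i * e i\<bar> \<le> B / \<gamma> + 1"
  proof -
    have "\<forall>\<^sub>F i in L. \<bar>s i / l i * e i - s i * (g i - \<gamma>) / \<gamma>\<bar> < 1"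
      using main by (auto dest: tendstoD[of _ _ _ 1] simp: dist_real_def)
    then show ?thesis
      using g
    proof eventually_elim
      case (elim i)
      define X Y where "X = s i / l i * e i" and "Y = s i * (g i - \<gamma>) / \<gamma>"
      have "\<bar>Y\<bar> \<le> B / \<gamma>"
        using elim(2) \<gamma> by (simp add: Y_def divide_right_mono)
      moreover have "\<bar>X - Y\<bar> < 1"
        using elim(1) by (simp add: X_def Y_def)
      ultimately have "\<bar>X\<bar> \<le> B / \<gamma> + 1"
        by linarith
      then show ?case by (simp only: X_def)
    qed
  qed
  have e_lim: "(e \<longlongrightarrow> 0) L"
  proof (rule Lim_null_comparison)
    show "((\<lambda>i. (B / \<gamma> + 1) * (l i / s i)) \<longlongrightarrow> 0) L"
      by (rule tendsto_mult_right_zero[OF l_s])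
    show "\<forall>\<^sub>F i in L. norm (e i) \<le> (B / \<gamma> + 1) * (l i / s i)"
      using bnd s_pos l_pos
    proof eventually_elim
      case (elim i)
      have "norm (e i) = \<bar>s i / l i * e i\<bar> * (l i / s i)"
        using elim by (simp add: abs_mult)
      also have "\<dots> \<le> (B / \<gamma> + 1) * (l i / s i)"
        using elim by (intro mult_right_mono) auto
      finally show ?case .
    qed
  qed
  have "(exp has_field_derivative 1) (at (0::real))"
    by (auto intro!: derivative_eq_intros)
  from scaled_linearization[OF this e_lim bnd] have "((\<lambda>i. s i / l i * (exp (e i) - exp 0 - 1 * e i)) \<longlongrightarrow> 0) L" .
  from tendsto_add[OF this main]
  have "((\<lambda>i. s i / l i * (exp (e i) - 1) - s i * (g i - \<gamma>) / \<gamma>) \<longlongrightarrow> 0) L"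
    by (simp add: algebra_simps add_divide_distrib diff_divide_distrib)
  then show ?thesis
    by (rule Lim_transform_eventually) (use q in eventually_elim, simp add: e_def)
qed

section \<open>The second-order tail class\<close>

lemma tail_class_cdf:
  assumes "F \<in> tail_class \<gamma> \<tau>"
  shows "mono F" and "(F \<longlongrightarrow> 1) at_top"
proof -
  obtain \<mu> where "real_distribution \<mu>" and F: "F = cdf \<mu>"
    using assms by (auto simp: tail_class_def distribution_function_def)
  then interpret real_distribution \<mu> by simp
  show "mono F"
    unfolding F by (auto intro!: monoI cdf_nondecreasing)
  show "(F \<longlongrightarrow> 1) at_top"
    unfolding F by (rule cdf_lim_at_top_prob)
qed

text \<open>
  The positive limit \<open>C\<close> forces \<open>1 - F\<close> to be positive far out, and \<open>1 - F\<close> decreases.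
\<close>

lemma tail_class_less_1:
  assumes F: "F \<in> tail_class \<gamma> \<tau>"
  shows "F x < 1"
proof -
  obtain C where "C > 0" "((\<lambda>x. x powr (1 / \<gamma>) * (1 - F x)) \<longlongrightarrow> C) at_top"
    using F by (auto simp: tail_class_def)
  then have "\<forall>\<^sub>F y in at_top. y powr (1 / \<gamma>) * (1 - F y) > 0"
    by (intro order_tendstoD)
  then have "\<forall>\<^sub>F y in at_top. F y < 1 \<and> y \<ge> x"
    using eventually_ge_at_top[of x] by eventually_elim (simp add: zero_less_mult_iff)
  then obtain y where "F y < 1" "x \<le> y"
    by (auto simp: eventually_at_top_linorder)
  then show ?thesis
    using monoD[OF tail_class_cdf(1)[OF F], of x y] by simp
qed

lemma tail_delta_tendsto_0:
  assumes F: "F \<in> tail_class \<gamma> \<tau>"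
  shows "(tail_delta \<gamma> F \<longlongrightarrow> 0) at_top"
proof -
  obtain C where C: "C > 0" and lim: "((\<lambda>x. x powr (1 / \<gamma>) * (1 - F x)) \<longlongrightarrow> C) at_top"
    using F by (auto simp: tail_class_def)
  have "((\<lambda>x. \<gamma> * (x powr (1 / \<gamma>) * (1 - F x) / C - 1)) \<longlongrightarrow> \<gamma> * (C / C - 1)) at_top"
    by (intro tendsto_intros lim) (use C in auto)
  then show ?thesis
    using C by (simp add: tail_delta_def[abs_def] tail_const_eqI[OF lim])
qed

text \<open>
  The infimum that defines the quantile behaves as intended only for a nonempty set that is bounded
  below; \<open>F 0 = 0\<close> supplies the lower bound. Strict inequalities avoid the question of whether the
  infimum is attained.
\<close>

lemma quantile_less_imp:
  assumes "mono F" "(F \<longlongrightarrow> 1) at_top" "F 0 = 0" "0 < q" "q < 1"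
  shows "quantile F q < v \<Longrightarrow> q \<le> F v" and "v < quantile F q \<Longrightarrow> F v < q"
proof -
  let ?S = "{x. F x \<ge> q}"
  have "\<forall>\<^sub>F x in at_top. F x > q"
    using assms by (intro order_tendstoD)
  then have ne: "?S \<noteq> {}"
    by (auto simp: eventually_at_top_linorder intro: less_imp_le)
  have bdd: "bdd_below ?S"
  proof (rule bdd_belowI)
    fix x assume "x \<in> ?S"
    then show "0 \<le> x"
      using monoD[OF assms(1), of x 0] assms(3,4) by (cases "x \<le> 0") auto
  qed
  show "q \<le> F v" if less: "quantile F q < v"
  proof -
    obtain x where "q \<le> F x" "x < v"
      using cInf_lessD[OF ne, of v] less unfolding quantile_def by auto
    then show ?thesis using monoD[OF assms(1), of x v] by simp
  qed
  show "F v < q" if "v < quantile F q"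
    using cInf_lower[OF _ bdd, of v] that by (force simp: quantile_def)
qed

text \<open>
  The bound on \<open>tail_a\<close> at \<open>m\<close> is turned into a bound on \<open>\<delta>\<close> near the tail quantile \<open>U m\<close>. Since \<open>F\<close>
  may jump at \<open>U m\<close>, the value \<open>1 - F (U m)\<close> is not \<open>1 / m\<close>, but just above \<open>U m\<close> it is at most
  \<open>1 / m\<close> and just below it exceeds \<open>1 / m\<close>. The first gives an upper bound on \<open>\<delta>\<close>, the second a lower
  bound, and as \<open>\<delta>\<close> has an eventual sign \<open>\<sigma>\<close>, one of the two bounds \<open>\<bar>\<delta>\<bar>\<close>. So \<open>U m\<close> is moved by the
  relative amount \<open>\<sigma> / s\<close> to the point \<open>v\<close>, which changes everything only by \<open>O(1 / s)\<close>. The points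
  \<open>w = v / 2\<close> have the limiting ratio \<open>2 powr (1 / \<gamma>)\<close>, which exceeds 1; so they eventually lie
  strictly below every point whose tail probability is close to \<open>1 / m\<close>.
\<close>

lemma tail_class_reference_points:
  fixes m s :: "'i \<Rightarrow> real"
  assumes F: "F \<in> tail_class \<gamma> \<tau>" and \<gamma>: "\<gamma> > 0" and F0: "F 0 = 0"
    and m: "filterlim m at_top L" and s: "filterlim s at_top L"
    and lim: "((\<lambda>i. s i * tail_a \<gamma> F (m i)) \<longlongrightarrow> lam) L"
  obtains w B where "filterlim w at_top L"
    and "\<forall>\<^sub>F i in L. s i * \<bar>tail_delta \<gamma> F (w i)\<bar> \<le> B"
    and "((\<lambda>i. m i * (1 - F (w i))) \<longlongrightarrow> 2 powr (1 / \<gamma>)) L"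
proof -
  define C where "C = tail_const \<gamma> F"
  define \<delta> where "\<delta> = tail_delta \<gamma> F"
  define a where "a i = tail_a \<gamma> F (m i)" for i
  have C: "C > 0"
    using tail_const_pos[OF F] by (simp add: C_def)
  obtain \<sigma> :: real where \<sigma>: "\<sigma> = 1 \<or> \<sigma> = -1" and sgn: "\<forall>\<^sub>F y in at_top. \<sigma> * \<delta> y > 0"
  proof -
    consider "\<forall>\<^sub>F y in at_top. \<delta> y > 0" | "\<forall>\<^sub>F y in at_top. \<delta> y < 0"
      using F by (auto simp: tail_class_def \<delta>_def)
    then show thesis
      by cases (auto intro: that[of 1] that[of "-1"])
  qed
  have s_pos: "\<forall>\<^sub>F i in L. s i > 2" and m_pos: "\<forall>\<^sub>F i in L. m i > 1"
    using s m by (auto simp: filterlim_at_top_dense)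
  \<comment> \<open>\<open>1 + r\<close> is the ratio of the shifted quantile \<open>v\<close> to its first-order value \<open>C powr \<gamma> * m powr \<gamma>\<close>.\<close>
  define r where "r i = (1 + a i) * (1 + \<sigma> / s i) - 1" for i
  have inv: "((\<lambda>i. inverse (s i)) \<longlongrightarrow> 0) L"
    by (rule tendsto_inverse_0_at_top[OF s])
  have a_lim: "(a \<longlongrightarrow> 0) L"
  proof -
    have "((\<lambda>i. s i * a i * inverse (s i)) \<longlongrightarrow> lam * 0) L"
      unfolding a_def by (intro tendsto_mult lim inv)
    then have "((\<lambda>i. s i * a i * inverse (s i)) \<longlongrightarrow> 0) L"
      by simp
    then show ?thesis
      by (rule Lim_transform_eventually) (use s_pos in eventually_elim, simp)
  qed
  have r_lim: "(r \<longlongrightarrow> 0) L"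
  proof -
    have "((\<lambda>i. (1 + a i) * (1 + \<sigma> * inverse (s i)) - 1) \<longlongrightarrow> (1 + 0) * (1 + \<sigma> * 0) - 1) L"
      by (intro tendsto_intros a_lim inv)
    then show ?thesis by (simp add: r_def[abs_def] divide_inverse)
  qed
  have sr_lim: "((\<lambda>i. s i * r i) \<longlongrightarrow> lam + \<sigma>) L"
  proof -
    have "((\<lambda>i. s i * a i + \<sigma> * (1 + a i)) \<longlongrightarrow> lam + \<sigma> * (1 + 0)) L"
      unfolding a_def by (intro tendsto_intros lim a_lim[unfolded a_def])
    then have "((\<lambda>i. s i * a i + \<sigma> * (1 + a i)) \<longlongrightarrow> lam + \<sigma>) L"
      by simp
    then show ?thesis
      by (rule Lim_transform_eventually) (use s_pos in eventually_elim, simp add: r_def field_simps)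
  qed
  define v where "v i = C powr \<gamma> * m i powr \<gamma> * (1 + r i)" for i
  have v_eq: "v i = tail_quantile F (m i) * (1 + \<sigma> / s i)" if "m i > 1" for i
    using tail_quantile_eq_tail_a[OF F, of "m i"] that
    by (simp add: v_def r_def C_def a_def)
  have r_ge: "\<forall>\<^sub>F i in L. r i > -1" and a_ge: "\<forall>\<^sub>F i in L. a i > -1"
    using r_lim a_lim by (auto intro: order_tendstoD)
  have v_lim: "filterlim v at_top L"
  proof -
    have "filterlim (\<lambda>i. (C powr \<gamma> * (1 + r i)) * m i powr \<gamma>) at_top L"
    proof (rule filterlim_tendsto_pos_mult_at_top)
      show "((\<lambda>i. C powr \<gamma> * (1 + r i)) \<longlongrightarrow> C powr \<gamma> * (1 + 0)) L"
        by (intro tendsto_intros r_lim)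
      show "filterlim (\<lambda>i. m i powr \<gamma>) at_top L"
      proof (rule filterlim_mono_eventually)
        show "filterlim (\<lambda>i. exp (\<gamma> * ln (m i))) at_top L"
          by (intro filterlim_compose[OF exp_at_top] filterlim_compose[OF ln_at_top m]
              filterlim_tendsto_pos_mult_at_top[OF tendsto_const \<gamma>])
        show "\<forall>\<^sub>F i in L. exp (\<gamma> * ln (m i)) = m i powr \<gamma>"
          using m_pos by eventually_elim (simp add: powr_def)
      qed simp_all
    qed (use C in simp)
    then show ?thesis by (simp add: v_def[abs_def] mult_ac)
  qed
  have tail: "1 - F y = C * y powr (- 1 / \<gamma>) * (1 + \<delta> y / \<gamma>)" if "y > 0" for y
    using tail_eq_tail_delta[OF F \<gamma> that] by (simp add: C_def \<delta>_def)
  have \<delta>v: "\<forall>\<^sub>F i in L. \<bar>\<delta> (v i)\<bar> \<le> \<sigma> * \<gamma> * ((1 + r i) powr (1 / \<gamma>) - 1)"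
    using s_pos m_pos r_ge a_ge filterlim_iff[THEN iffD1, OF v_lim, rule_format, OF sgn]
  proof eventually_elim
    case (elim i)
    let ?U = "tail_quantile F (m i)"
    have U: "?U > 0"
      using tail_quantile_eq_tail_a[OF F, of "m i"] elim C by (simp add: C_def a_def)
    have v0: "v i > 0"
      using elim C by (simp add: v_def)
    have q: "0 < 1 - 1 / m i" "1 - 1 / m i < 1"
      using elim by auto
    note quant = quantile_less_imp[OF tail_class_cdf[OF F] F0 q, folded tail_quantile_def]
    have "\<sigma> * (1 - F (v i)) \<le> \<sigma> * (1 / m i)"
    proof (cases "\<sigma> = 1")
      case True
      then have "?U < v i"
        using U elim by (simp add: v_eq algebra_simps)
      from quant(1)[OF this] True show ?thesis by simp
    next
      case False
      then have "v i < ?U"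
        using U elim \<sigma> by (simp add: v_eq algebra_simps)
      from quant(2)[OF this] False \<sigma> show ?thesis by auto
    qed
    then have "\<sigma> * (1 - F (v i)) * (v i powr (1 / \<gamma>) / C) \<le> \<sigma> * (1 / m i) * (v i powr (1 / \<gamma>) / C)"
      using C by (intro mult_right_mono) auto
    also have "v i powr (1 / \<gamma>) = C * m i * (1 + r i) powr (1 / \<gamma>)"
      using C elim \<gamma> by (simp add: v_def powr_mult powr_powr)
    also have "\<sigma> * (1 / m i) * (C * m i * (1 + r i) powr (1 / \<gamma>) / C) = \<sigma> * (1 + r i) powr (1 / \<gamma>)"
      using C elim by simp
    also have "\<sigma> * (1 - F (v i)) * (C * m i * (1 + r i) powr (1 / \<gamma>) / C) = \<sigma> * (1 + \<delta> (v i) / \<gamma>)"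
    proof -
      have "C * m i * (1 + r i) powr (1 / \<gamma>) = v i powr (1 / \<gamma>)"
        using C elim \<gamma> by (simp add: v_def powr_mult powr_powr)
      then show ?thesis
        using v0 C by (simp add: tail powr_minus field_simps)
    qed
    finally have "\<sigma> * \<delta> (v i) / \<gamma> \<le> \<sigma> * ((1 + r i) powr (1 / \<gamma>) - 1)"
      by (simp add: algebra_simps)
    then have "\<sigma> * \<delta> (v i) \<le> \<sigma> * \<gamma> * ((1 + r i) powr (1 / \<gamma>) - 1)"
      using \<gamma> by (simp add: field_simps)
    moreover have "\<bar>\<delta> (v i)\<bar> = \<sigma> * \<delta> (v i)"
      using elim \<sigma> by auto
    ultimately show ?case by simp
  qed
  have s\<delta>v: "\<forall>\<^sub>F i in L. s i * \<bar>\<delta> (v i)\<bar> \<le> \<bar>\<sigma>\<bar> * (\<bar>lam + \<sigma>\<bar> + 1) + \<gamma>"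
  proof -
    have "((\<lambda>x. (1 + x) powr (1 / \<gamma>)) has_field_derivative 1 / \<gamma>) (at (0::real))"
      by (auto intro!: derivative_eq_intros)
    moreover have b: "\<forall>\<^sub>F i in L. \<bar>s i * r i\<bar> \<le> \<bar>lam + \<sigma>\<bar> + 1"
      using order_tendstoD(2)[OF tendsto_rabs[OF sr_lim], of "\<bar>lam + \<sigma>\<bar> + 1"]
      by (auto elim: eventually_mono)
    ultimately have "((\<lambda>i. s i * ((1 + r i) powr (1 / \<gamma>) - 1 - r i / \<gamma>)) \<longlongrightarrow> 0) L"
      using scaled_linearization[OF _ r_lim, of _ _ s] by fastforce
    then have "\<forall>\<^sub>F i in L. \<bar>s i * ((1 + r i) powr (1 / \<gamma>) - 1 - r i / \<gamma>)\<bar> < 1"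
      by (auto dest: tendstoD[of _ _ _ 1] simp: dist_real_def)
    then show ?thesis
      using \<delta>v b s_pos
    proof eventually_elim
      case (elim i)
      let ?e = "(1 + r i) powr (1 / \<gamma>) - 1 - r i / \<gamma>"
      have "s i * \<bar>\<delta> (v i)\<bar> \<le> s i * (\<sigma> * \<gamma> * ((1 + r i) powr (1 / \<gamma>) - 1))"
        using elim by (intro mult_left_mono) auto
      also have "\<dots> = \<sigma> * (s i * r i) + \<gamma> * (\<sigma> * (s i * ?e))"
        using \<gamma> by (simp add: field_simps)
      also have "\<dots> \<le> \<bar>\<sigma>\<bar> * (\<bar>lam + \<sigma>\<bar> + 1) + \<gamma> * 1"
      proof (intro add_mono mult_left_mono)
        show "\<sigma> * (s i * r i) \<le> \<bar>\<sigma>\<bar> * (\<bar>lam + \<sigma>\<bar> + 1)"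
          using \<sigma> elim by auto
        show "\<sigma> * (s i * ?e) \<le> 1"
          using \<sigma> elim by auto
      qed (use \<gamma> in simp)
      finally show ?case by simp
    qed
  qed
  define w where "w i = v i * (1 / 2)" for i
  have w_lim: "filterlim w at_top L"
    unfolding w_def using filterlim_tendsto_pos_mult_at_top[OF tendsto_const _ v_lim, of "1/2"]
    by (simp add: mult.commute)
  have "regularly_varying (\<lambda>y. \<bar>\<delta> y\<bar>) \<tau>"
    using F by (simp add: tail_class_def \<delta>_def)
  then have "((\<lambda>y. \<bar>\<delta> (y * (1 / 2))\<bar> / \<bar>\<delta> y\<bar>) \<longlongrightarrow> (1 / 2) powr \<tau>) at_top"
    unfolding regularly_varying_def by (metis half_gt_zero zero_less_one)
  then have "\<forall>\<^sub>F y in at_top. \<bar>\<delta> (y * (1 / 2))\<bar> / \<bar>\<delta> y\<bar> < (1 / 2) powr \<tau> + 1"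
    by (rule order_tendstoD) simp
  then have "\<forall>\<^sub>F i in L. \<bar>\<delta> (w i)\<bar> / \<bar>\<delta> (v i)\<bar> < (1 / 2) powr \<tau> + 1"
    unfolding w_def by (rule filterlim_iff[THEN iffD1, OF v_lim, rule_format])
  then have "\<forall>\<^sub>F i in L. s i * \<bar>\<delta> (w i)\<bar>
      \<le> ((1 / 2) powr \<tau> + 1) * (\<bar>\<sigma>\<bar> * (\<bar>lam + \<sigma>\<bar> + 1) + \<gamma>)"
    using s\<delta>v s_pos filterlim_iff[THEN iffD1, OF v_lim, rule_format, OF sgn]
  proof eventually_elim
    case (elim i)
    then have "\<bar>\<delta> (v i)\<bar> > 0" by auto
    then have "\<bar>\<delta> (w i)\<bar> \<le> ((1 / 2) powr \<tau> + 1) * \<bar>\<delta> (v i)\<bar>"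
      using elim by (simp add: divide_less_eq)
    then have "s i * \<bar>\<delta> (w i)\<bar> \<le> s i * (((1 / 2) powr \<tau> + 1) * \<bar>\<delta> (v i)\<bar>)"
      using elim by (intro mult_left_mono) auto
    also have "\<dots> = ((1 / 2) powr \<tau> + 1) * (s i * \<bar>\<delta> (v i)\<bar>)"
      by simp
    also have "\<dots> \<le> ((1 / 2) powr \<tau> + 1) * (\<bar>\<sigma>\<bar> * (\<bar>lam + \<sigma>\<bar> + 1) + \<gamma>)"
      using elim by (intro mult_left_mono) (auto intro: add_nonneg_nonneg)
    finally show ?case .
  qed
  moreover have "((\<lambda>i. m i * (1 - F (w i))) \<longlongrightarrow> 2 powr (1 / \<gamma>)) L"
  proof -
    have "((\<lambda>i. 2 powr (1 / \<gamma>) * (1 + r i) powr (- 1 / \<gamma>) * (1 + \<delta> (w i) / \<gamma>)) \<longlongrightarrow>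
        2 powr (1 / \<gamma>) * (1 + 0) powr (- 1 / \<gamma>) * (1 + 0 / \<gamma>)) L"
      unfolding \<delta>_def
      by (intro tendsto_intros r_lim filterlim_compose[OF tail_delta_tendsto_0[OF F] w_lim])
        (use \<gamma> in auto)
    then have "((\<lambda>i. 2 powr (1 / \<gamma>) * (1 + r i) powr (- 1 / \<gamma>) * (1 + \<delta> (w i) / \<gamma>)) \<longlongrightarrow>
        2 powr (1 / \<gamma>)) L"
      by simp
    then show ?thesis
    proof (rule Lim_transform_eventually)
      show "\<forall>\<^sub>F i in L. 2 powr (1 / \<gamma>) * (1 + r i) powr (- 1 / \<gamma>) * (1 + \<delta> (w i) / \<gamma>) =
          m i * (1 - F (w i))"
        using m_pos r_ge
      proof eventually_elim
        case (elim i)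
        have "w i > 0"
          using elim C by (simp add: w_def v_def)
        moreover have "w i powr (- 1 / \<gamma>) = 2 powr (1 / \<gamma>) * (1 + r i) powr (- 1 / \<gamma>) / (C * m i)"
        proof -
          have "v i > 0" "v i powr (1 / \<gamma>) = C * m i * (1 + r i) powr (1 / \<gamma>)"
            using C elim \<gamma> by (simp_all add: v_def powr_mult powr_powr)
          then show ?thesis
            by (simp add: w_def powr_divide powr_minus_divide)
        qed
        ultimately show ?case
          using elim C by (simp add: tail)
      qed
    qed
  qed
  ultimately show thesis
    using that w_lim by (auto simp: \<delta>_def)
qed

section \<open>Expansion of the tail probability estimator\<close>

text \<open>
  The deterministic core, along an arbitrary filter: the scaled errors of \<open>gh\<close>, \<open>dh\<close> and
  \<open>m * (1 - F y)\<close> need only be bounded. For \<open>th\<close> crude two-sided bounds suffice: the upper one,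
  below 0, keeps the factor \<open>1 - (x / y) powr th\<close> between 0 and 1, and the lower one keeps \<open>1 / th\<close>
  below a negative constant, so that the null sequence \<open>dh\<close> ends up in the parameter range.
\<close>

lemma epd_relative_error_expansion:
  fixes m s x y gh dh th q :: "'i \<Rightarrow> real"
  assumes F: "F \<in> tail_class \<gamma> \<tau>" and \<gamma>: "\<gamma> > 0" and \<tau>: "\<tau> < 0" and F0: "F 0 = 0"
    and m: "filterlim m at_top L" and s: "filterlim s at_top L"
    and a: "((\<lambda>i. s i * tail_a \<gamma> F (m i)) \<longlongrightarrow> lam) L"
    and x: "filterlim x at_top L"
    and p0: "((\<lambda>i. m i * (1 - F (x i))) \<longlongrightarrow> 0) L"
    and lnp: "((\<lambda>i. ln (m i * (1 - F (x i))) / s i) \<longlongrightarrow> 0) L"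
    and gh: "\<forall>\<^sub>F i in L. \<bar>s i * (gh i - \<gamma>)\<bar> \<le> K"
    and dh: "\<forall>\<^sub>F i in L. \<bar>s i * (dh i - tail_delta \<gamma> F (y i))\<bar> \<le> K"
    and y: "\<forall>\<^sub>F i in L. \<bar>s i * (m i * (1 - F (y i)) - 1)\<bar> \<le> K"
    and th: "\<forall>\<^sub>F i in L. \<bar>th i - \<tau>\<bar> \<le> - \<tau> / 2"
    and q: "\<forall>\<^sub>F i in L. epd_params (gh i) (dh i) (th i) \<longrightarrow>
              q i = 1 / m i * (1 - epd_cdf (gh i) (dh i) (th i) (x i / y i))"
  shows "((\<lambda>i. s i / ln (1 / (m i * (1 - F (x i)))) * (q i / (1 - F (x i)) - 1)
            - s i * (gh i - \<gamma>) / \<gamma>) \<longlongrightarrow> 0) L"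
proof -
  define C where "C = tail_const \<gamma> F"
  define \<delta> where "\<delta> = tail_delta \<gamma> F"
  define \<rho> where "\<rho> i = m i * (1 - F (y i)) - 1" for i
  define z where "z i = dh i * (1 - (x i / y i) powr th i)" for i
  define l where "l i = ln (1 / (m i * (1 - F (x i))))" for i
  define u where "u i = \<gamma> * (ln (1 + \<rho> i) + ln (1 + \<delta> (x i) / \<gamma>) - ln (1 + \<delta> (y i) / \<gamma>))
    + ln (1 + z i)" for i
  have C: "C > 0"
    using tail_const_pos[OF F] by (simp add: C_def)
  have tail: "1 - F v = C * v powr (- 1 / \<gamma>) * (1 + \<delta> v / \<gamma>)" if "v > 0" for v
    using tail_eq_tail_delta[OF F \<gamma> that] by (simp add: C_def \<delta>_def)
  have tail_pos: "1 - F v > 0" for v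
    using tail_class_less_1[OF F] by simp
  note mono = monoD[OF tail_class_cdf(1)[OF F]]
  have s_pos: "\<forall>\<^sub>F i in L. s i > 0" and m_pos: "\<forall>\<^sub>F i in L. m i > 0"
    using s m by (auto simp: filterlim_at_top_dense)
  have \<rho>_bound: "\<forall>\<^sub>F i in L. \<bar>s i * \<rho> i\<bar> \<le> K"
    using y by (simp add: \<rho>_def)
  have \<rho>_lim: "(\<rho> \<longlongrightarrow> 0) L"
    by (rule tendsto_0_of_scaled_bounded[OF s \<rho>_bound])

  obtain w B where w: "filterlim w at_top L"
    and w_bound: "\<forall>\<^sub>F i in L. s i * \<bar>\<delta> (w i)\<bar> \<le> B"
    and w_tail: "((\<lambda>i. m i * (1 - F (w i))) \<longlongrightarrow> 2 powr (1 / \<gamma>)) L"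
    using tail_class_reference_points[OF F \<gamma> F0 m s a] unfolding \<delta>_def by blast
  have "regularly_varying (\<lambda>v. \<bar>\<delta> v\<bar>) \<tau>"
    using F by (simp add: tail_class_def \<delta>_def)
  then obtain K' x0 where K': "\<And>u v. u \<ge> x0 \<Longrightarrow> v \<ge> u \<Longrightarrow> \<bar>\<delta> v\<bar> \<le> K' * \<bar>\<delta> u\<bar>"
    using regularly_varying_quasi_decreasing[OF _ \<tau>] by blast
  have w_large: "\<forall>\<^sub>F i in L. w i \<ge> max x0 1"
    using w unfolding filterlim_at_top by blast

  have w_less_y: "\<forall>\<^sub>F i in L. w i < y i"
  proof -
    \<comment> \<open>A level strictly between 1, the limit of \<open>m * (1 - F (y i))\<close>, and the limit at \<open>w\<close>.\<close>
    define c where "c = (1 + 2 powr (1 / \<gamma>)) / 2"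
    have "1 < 2 powr (1 / \<gamma>)"
      using \<gamma> by (simp add: gr_one_powr)
    then have c: "0 < c - 1" "c < 2 powr (1 / \<gamma>)"
      by (auto simp: c_def)
    have "\<forall>\<^sub>F i in L. \<rho> i < c - 1" "\<forall>\<^sub>F i in L. c < m i * (1 - F (w i))"
      using \<rho>_lim w_tail c by (auto intro: order_tendstoD)
    then show ?thesis
      using m_pos
    proof eventually_elim
      case (elim i)
      then have "m i * (1 - F (y i)) < m i * (1 - F (w i))"
        unfolding \<rho>_def by linarith
      then have "F (w i) < F (y i)"
        using elim(3) by (simp add: mult_less_cancel_left_pos)
      then show ?case
        using mono[of "y i" "w i"] by (cases "y i \<le> w i") auto
    qed
  qed
  have y_less_x: "\<forall>\<^sub>F i in L. y i < x i"
  proof -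
    have "\<forall>\<^sub>F i in L. \<rho> i > - 1 / 2" "\<forall>\<^sub>F i in L. m i * (1 - F (x i)) < 1 / 2"
      by (rule order_tendstoD(1)[OF \<rho>_lim], simp, rule order_tendstoD(2)[OF p0], simp)
    then show ?thesis
      using m_pos
    proof eventually_elim
      case (elim i)
      then have "m i * (1 - F (x i)) < m i * (1 - F (y i))"
        unfolding \<rho>_def by linarith
      then have "F (y i) < F (x i)"
        using elim(3) by (simp add: mult_less_cancel_left_pos)
      then show ?case
        using mono[of "x i" "y i"] by (cases "x i \<le> y i") auto
    qed
  qed

  \<comment> \<open>Quasi-monotonicity carries the bound at \<open>w\<close> to all points beyond it, in particular to \<open>y\<close> and \<open>x\<close>.\<close>
  have \<delta>_bound: "\<forall>\<^sub>F i in L. \<forall>v\<ge>w i. \<bar>s i * \<delta> v\<bar> \<le> \<bar>K'\<bar> * B"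
    using w_bound w_large s_pos
  proof eventually_elim
    case (elim i)
    show ?case
    proof (intro allI impI)
      fix v assume "v \<ge> w i"
      then have "\<bar>\<delta> v\<bar> \<le> K' * \<bar>\<delta> (w i)\<bar>"
        using elim by (intro K') auto
      also have "\<dots> \<le> \<bar>K'\<bar> * \<bar>\<delta> (w i)\<bar>"
        by (intro mult_right_mono) auto
      finally have "\<bar>s i * \<delta> v\<bar> \<le> s i * (\<bar>K'\<bar> * \<bar>\<delta> (w i)\<bar>)"
        using elim by (simp add: abs_mult)
      also have "\<dots> = \<bar>K'\<bar> * (s i * \<bar>\<delta> (w i)\<bar>)"
        by simp
      also have "\<dots> \<le> \<bar>K'\<bar> * B"
        using elim by (intro mult_left_mono) auto
      finally show "\<bar>s i * \<delta> v\<bar> \<le> \<bar>K'\<bar> * B" .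
    qed
  qed
  have \<delta>y: "\<forall>\<^sub>F i in L. \<bar>s i * \<delta> (y i)\<bar> \<le> \<bar>K'\<bar> * B"
    using \<delta>_bound w_less_y by eventually_elim simp
  have \<delta>x: "\<forall>\<^sub>F i in L. \<bar>s i * \<delta> (x i)\<bar> \<le> \<bar>K'\<bar> * B"
    using \<delta>_bound w_less_y y_less_x by eventually_elim simp
  have scale: "\<forall>\<^sub>F i in L. \<bar>s i * (\<delta> (v i) / \<gamma>)\<bar> \<le> \<bar>K'\<bar> * B / \<gamma>"
    if "\<forall>\<^sub>F i in L. \<bar>s i * \<delta> (v i)\<bar> \<le> \<bar>K'\<bar> * B" for v
    using that by eventually_elim (use \<gamma> in \<open>simp add: divide_right_mono\<close>)

  have dh_bound: "\<forall>\<^sub>F i in L. \<bar>s i * dh i\<bar> \<le> K + \<bar>K'\<bar> * B"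
    using dh \<delta>y
  proof eventually_elim
    case (elim i)
    have "s i * dh i = s i * (dh i - \<delta> (y i)) + s i * \<delta> (y i)"
      by (simp add: algebra_simps)
    then show ?case
      using elim by (simp add: \<delta>_def)
  qed
  have dh_lim: "(dh \<longlongrightarrow> 0) L"
    by (rule tendsto_0_of_scaled_bounded[OF s dh_bound])
  have z_le: "\<forall>\<^sub>F i in L. \<bar>z i\<bar> \<le> \<bar>dh i\<bar>"
    using w_large w_less_y y_less_x th
  proof eventually_elim
    case (elim i)
    then have "th i < 0" "1 \<le> x i / y i"
      using \<tau> by auto
    then have "(x i / y i) powr th i \<le> 1"
      using powr_mono[of "th i" 0 "x i / y i"] by (auto split: if_splits)
    then have "\<bar>1 - (x i / y i) powr th i\<bar> \<le> 1"
      by (simp add: abs_le_iff)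
    then show ?case
      by (simp add: z_def abs_mult mult_left_le)
  qed
  have z_bound: "\<forall>\<^sub>F i in L. \<bar>s i * z i\<bar> \<le> K + \<bar>K'\<bar> * B"
    using z_le dh_bound
  proof eventually_elim
    case (elim i)
    have "\<bar>s i * z i\<bar> \<le> \<bar>s i * dh i\<bar>"
      using elim by (simp add: abs_mult mult_left_mono)
    then show ?case using elim by simp
  qed

  have u_bound: "\<forall>\<^sub>F i in L. \<bar>s i * u i\<bar> \<le>
      \<gamma> * ((K + 1) + (\<bar>K'\<bar> * B / \<gamma> + 1) + (\<bar>K'\<bar> * B / \<gamma> + 1)) + (K + \<bar>K'\<bar> * B + 1)"
    using scaled_ln_bounded[OF s \<rho>_bound] scaled_ln_bounded[OF s scale[OF \<delta>x]]
      scaled_ln_bounded[OF s scale[OF \<delta>y]] scaled_ln_bounded[OF s z_bound]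
  proof eventually_elim
    case (elim i)
    let ?t = "s i * ln (1 + \<rho> i) + s i * ln (1 + \<delta> (x i) / \<gamma>) - s i * ln (1 + \<delta> (y i) / \<gamma>)"
    have "\<bar>a + b - c\<bar> \<le> a' + b' + c'" if "\<bar>a\<bar> \<le> a'" "\<bar>b\<bar> \<le> b'" "\<bar>c\<bar> \<le> c'"
      for a b c a' b' c' :: real
      using that by linarith
    note t_le = this[OF elim(1-3)]
    have "s i * u i = \<gamma> * ?t + s i * ln (1 + z i)"
      by (simp add: u_def algebra_simps)
    also have "\<bar>\<dots>\<bar> \<le> \<gamma> * \<bar>?t\<bar> + \<bar>s i * ln (1 + z i)\<bar>"
      using abs_triangle_ineq[of "\<gamma> * ?t" "s i * ln (1 + z i)"] \<gamma> by (simp add: abs_mult)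
    also have "\<dots> \<le> \<gamma> * ((K + 1) + (\<bar>K'\<bar> * B / \<gamma> + 1) + (\<bar>K'\<bar> * B / \<gamma> + 1)) + (K + \<bar>K'\<bar> * B + 1)"
      using t_le elim(4) \<gamma> by (intro add_mono mult_left_mono) simp_all
    finally show ?case .
  qed

  have l_eq: "\<forall>\<^sub>F i in L. l i = - ln (m i * (1 - F (x i)))"
    using m_pos by eventually_elim (simp add: l_def ln_div tail_pos)
  have l_lim: "filterlim l at_top L"
  proof -
    have "filterlim (\<lambda>i. m i * (1 - F (x i))) (at_right 0) L"
      unfolding filterlim_at
    proof (intro conjI p0)
      show "\<forall>\<^sub>F i in L. m i * (1 - F (x i)) \<in> {0<..} \<and> m i * (1 - F (x i)) \<noteq> 0"
        using m_pos
      proof eventually_elim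
        case (elim i)
        then have "m i * (1 - F (x i)) > 0"
          using tail_pos by (intro mult_pos_pos)
        then show ?case by auto
      qed
    qed
    then have "filterlim (\<lambda>i. ln (m i * (1 - F (x i)))) at_bot L"
      by (rule filterlim_compose[OF ln_at_0])
    then have "filterlim (\<lambda>i. - ln (m i * (1 - F (x i)))) at_top L"
      by (simp add: filterlim_uminus_at_top)
    then show ?thesis
    proof (rule filterlim_mono_eventually)
      show "\<forall>\<^sub>F i in L. - ln (m i * (1 - F (x i))) = l i"
        using l_eq by eventually_elim simp
    qed simp_all
  qed
  have l_s: "((\<lambda>i. l i / s i) \<longlongrightarrow> 0) L"
  proof (rule Lim_transform_eventually)
    show "((\<lambda>i. - (ln (m i * (1 - F (x i))) / s i)) \<longlongrightarrow> 0) L"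
      using tendsto_minus[OF lnp] by simp
    show "\<forall>\<^sub>F i in L. - (ln (m i * (1 - F (x i))) / s i) = l i / s i"
      using l_eq by eventually_elim simp
  qed

  have params: "\<forall>\<^sub>F i in L. epd_params (gh i) (dh i) (th i)"
  proof -
    \<comment> \<open>\<open>2 / (3 * \<tau>)\<close> is the largest value of \<open>1 / th\<close> over \<open>3 * \<tau> / 2 \<le> th \<le> \<tau> / 2\<close>.\<close>
    have "\<forall>\<^sub>F i in L. dh i > -1" "\<forall>\<^sub>F i in L. dh i > 2 / (3 * \<tau>)"
      using dh_lim \<tau> by (auto intro!: order_tendstoD(1) simp: divide_less_0_iff)
    moreover have "(gh \<longlongrightarrow> \<gamma>) L"
      using tendsto_0_of_scaled_bounded[OF s gh] by (simp add: LIM_zero_iff)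
    then have "\<forall>\<^sub>F i in L. gh i > 0"
      using \<gamma> by (intro order_tendstoD)
    ultimately show ?thesis
      using th
    proof eventually_elim
      case (elim i)
      then have t: "th i < 0" "3 * \<tau> / 2 \<le> th i"
        using \<tau> by auto
      then have "1 / th i \<le> 2 / (3 * \<tau>)"
        using \<tau> by (simp add: divide_simps mult_less_0_iff)
      then show ?case
        using t elim by (auto simp: epd_params_def)
    qed
  qed
  have "\<forall>\<^sub>F i in L. q i / (1 - F (x i)) = exp (l i - (\<gamma> * l i + u i) / gh i)"
  proof -
    have "\<forall>\<^sub>F i in L. \<rho> i > -1" "\<forall>\<^sub>F i in L. \<bar>dh i\<bar> < 1"
      using order_tendstoD(1)[OF \<rho>_lim, of "-1"]
        order_tendstoD(2)[OF tendsto_rabs_zero[OF dh_lim], of 1] by simp_all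
    then show ?thesis
      using q params m_pos w_large w_less_y y_less_x z_le
    proof eventually_elim
      case (elim i)
      have pos: "y i > 0" "x i > 0" "1 + z i > 0" "x i / y i > 1"
        using elim by auto
      have \<delta>_pos: "1 + \<delta> v / \<gamma> > 0" if "v > 0" for v
        by (rule zero_less_mult_pos[OF tail_pos[of v, unfolded tail[OF that]]])
          (use C that in simp)
      have ln_tail: "ln (1 - F v) = ln C - ln v / \<gamma> + ln (1 + \<delta> v / \<gamma>)" if "v > 0" for v
        using \<delta>_pos[OF that] that C by (simp add: tail ln_mult ln_powr)
      have "l i = - ln (m i) - ln (1 - F (x i))"
        using elim tail_pos[of "x i"] by (simp add: l_def ln_div ln_mult)
      moreover have "ln (1 + \<rho> i) = ln (m i) + ln (1 - F (y i))"
        using elim tail_pos[of "y i"] by (simp add: \<rho>_def ln_mult)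
      ultimately have "\<gamma> * l i + u i = ln (x i) - ln (y i) + ln (1 + z i)"
        using \<gamma> pos by (simp add: u_def ln_tail field_simps)
      also have "\<dots> = ln (x i / y i * (1 + z i))"
        using pos by (simp add: ln_mult ln_div)
      finally have *: "\<gamma> * l i + u i = ln (x i / y i * (1 + z i))" .
      have "q i = 1 / m i * (x i / y i * (1 + z i)) powr (- 1 / gh i)"
        using elim pos by (simp add: epd_cdf_def z_def algebra_simps)
      also have "(x i / y i * (1 + z i)) powr (- 1 / gh i) = exp (- ((\<gamma> * l i + u i) / gh i))"
        using pos by (simp add: * powr_def)
      finally have "q i / (1 - F (x i)) = 1 / (m i * (1 - F (x i))) * exp (- ((\<gamma> * l i + u i) / gh i))"
        by simp
      also have "1 / (m i * (1 - F (x i))) = exp (l i)"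
        using elim tail_pos[of "x i"] by (simp add: l_def)
      finally show ?case
        by (simp add: exp_add[symmetric])
    qed
  qed
  from relative_error_expansion[OF s l_lim l_s \<gamma> gh u_bound this]
  show ?thesis by (simp add: l_def)
qed

section \<open>Order statistics\<close>

text \<open>
  Counting the entries up to a level determines every rank of a sorted list. Applied to an order
  statistic, this expresses its sublevel sets through a sum of indicators, which is visibly measurable.
\<close>

lemma length_filter_le_iff_nth_le:
  fixes xs :: "'a::linorder list"
  assumes "sorted xs" and "j < length xs"
  shows "xs ! j \<le> a \<longleftrightarrow> j < length (filter (\<lambda>y. y \<le> a) xs)"
  using assms
proof (induction xs arbitrary: j)
  case (Cons y xs)
  have empty: "filter (\<lambda>z. z \<le> a) xs = []" if "\<not> y \<le> a"
    using Cons.prems that by (force simp: filter_empty_conv)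
  show ?case
  proof (cases j)
    case 0
    then show ?thesis using empty by auto
  next
    case (Suc i)
    have "y \<le> xs ! i"
      using Cons.prems Suc by (auto simp: nth_mem)
    then show ?thesis
      using Cons Suc empty by auto
  qed
qed simp

lemma borel_measurable_order_statistic:
  assumes X: "\<And>i. X i \<in> borel_measurable M" and j: "1 \<le> j" "j \<le> n"
  shows "(\<lambda>\<omega>. order_statistic (\<lambda>i. X i \<omega>) j n) \<in> borel_measurable M"
proof (rule borel_measurable_iff_le[THEN iffD2], rule allI)
  fix a :: real
  have "order_statistic (\<lambda>i. X i \<omega>) j n \<le> a \<longleftrightarrow> real (j - 1) < (\<Sum>i<n. indicator {..a} (X i \<omega>))" for \<omega>
  proof -
    have "(\<Sum>i<n. indicator {..a} (X i \<omega>)) = real (length (filter (\<lambda>i. X i \<omega> \<le> a) [0..<n]))"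
      by (induction n) auto
    also have "\<dots> = real (length (filter (\<lambda>y. y \<le> a) (sort (map (\<lambda>i. X i \<omega>) [0..<n]))))"
      by (simp add: filter_sort filter_map o_def)
    finally show ?thesis
      unfolding order_statistic_def using j
      by (subst length_filter_le_iff_nth_le) auto
  qed
  moreover have "{\<omega> \<in> space M. real (j - 1) < (\<Sum>i<n. indicator {..a} (X i \<omega>))} \<in> sets M"
    using X by measurable
  ultimately show "{\<omega> \<in> space M. order_statistic (\<lambda>i. X i \<omega>) j n \<le> a} \<in> sets M"
    by simp
qed

section \<open>Convergence in distribution and in probability\<close>

text \<open>
  Test functions that vanish on the ball of radius \<open>K\<close> and equal 1 outside the ball of radius
  \<open>K + 1\<close> transfer the tail mass of the limit to the sequence.
\<close>

lemma conv_in_distr_imp_tight: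
  fixes Y :: "nat \<Rightarrow> 'a \<Rightarrow> 'c::{real_normed_vector, second_countable_topology}"
  assumes M: "prob_space M" and N: "prob_space N"
    and Y: "\<forall>\<^sub>F n in sequentially. Y n \<in> borel_measurable M"
    and Y0 [measurable]: "Y0 \<in> borel_measurable N"
    and conv: "conv_in_distr M Y N Y0" and "\<eta> > 0"
  shows "\<exists>K. \<forall>\<^sub>F n in sequentially. measure M {\<omega> \<in> space M. norm (Y n \<omega>) > K} < \<eta>"
proof -
  interpret M: prob_space M by fact
  interpret N: prob_space N by fact
  define \<phi> where "\<phi> K y = min 1 (max 0 (norm y - K))" for K :: real and y :: 'c
  have cont: "continuous_on UNIV (\<phi> K)" for K
    unfolding \<phi>_def by (intro continuous_intros)
  have [measurable]: "\<phi> K \<in> borel_measurable borel" for K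
    by (rule borel_measurable_continuous_onI[OF cont])
  have bounds: "0 \<le> \<phi> K y" "\<phi> K y \<le> 1" for K y
    by (auto simp: \<phi>_def)
  have "(\<lambda>m. \<integral>\<omega>. \<phi> (real m) (Y0 \<omega>) \<partial>N) \<longlonglongrightarrow> (\<integral>\<omega>. 0 \<partial>N)"
  proof (rule integral_dominated_convergence[where w = "\<lambda>_. 1"])
    show "AE \<omega> in N. (\<lambda>m. \<phi> (real m) (Y0 \<omega>)) \<longlonglongrightarrow> 0"
    proof (rule AE_I2)
      fix \<omega>
      have "\<forall>\<^sub>F m in sequentially. norm (Y0 \<omega>) \<le> real m"
        using filterlim_real_sequentially by (simp add: filterlim_at_top)
      then have "\<forall>\<^sub>F m in sequentially. \<phi> (real m) (Y0 \<omega>) = 0"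
        by eventually_elim (simp add: \<phi>_def)
      then show "(\<lambda>m. \<phi> (real m) (Y0 \<omega>)) \<longlonglongrightarrow> 0"
        by (rule tendsto_eventually)
    qed
  qed (use bounds in auto)
  then have "\<forall>\<^sub>F m in sequentially. (\<integral>\<omega>. \<phi> (real m) (Y0 \<omega>) \<partial>N) < \<eta>"
    using \<open>\<eta> > 0\<close> by (auto intro: order_tendstoD)
  then obtain m where m: "(\<integral>\<omega>. \<phi> (real m) (Y0 \<omega>) \<partial>N) < \<eta>"
    by (auto simp: eventually_sequentially)
  have "bounded (range (\<phi> (real m)))"
    using bounds by (auto simp: bounded_iff intro!: exI[of _ 1])
  then have "(\<lambda>n. \<integral>\<omega>. \<phi> (real m) (Y n \<omega>) \<partial>M) \<longlonglongrightarrow> (\<integral>\<omega>. \<phi> (real m) (Y0 \<omega>) \<partial>N)"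
    using conv cont by (auto simp: conv_in_distr_def)
  then have "\<forall>\<^sub>F n in sequentially. (\<integral>\<omega>. \<phi> (real m) (Y n \<omega>) \<partial>M) < \<eta>"
    using m by (rule order_tendstoD)
  then have "\<forall>\<^sub>F n in sequentially. measure M {\<omega> \<in> space M. norm (Y n \<omega>) > real m + 1} < \<eta>"
    using Y
  proof eventually_elim
    case (elim n)
    note [measurable] = elim(2)
    have int: "integrable M (\<lambda>\<omega>. \<phi> (real m) (Y n \<omega>))"
      by (rule M.integrable_const_bound[of _ 1]) (use bounds in auto)
    have "measure M {\<omega> \<in> space M. norm (Y n \<omega>) > real m + 1} =
        (\<integral>\<omega>. indicator {\<omega> \<in> space M. norm (Y n \<omega>) > real m + 1} \<omega> \<partial>M)"
      by simp
    also have "\<dots> \<le> (\<integral>\<omega>. \<phi> (real m) (Y n \<omega>) \<partial>M)"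
      by (intro integral_mono int)
        (auto simp: \<phi>_def less_top[symmetric] split: split_indicator)
    finally show ?case using elim(1) by simp
  qed
  then show ?thesis by blast
qed

text \<open>
  The continuous mapping theorem; it yields the marginal convergence of the first component.
\<close>

lemma conv_in_distr_compose:
  assumes "conv_in_distr M Y N Y0" and g: "continuous_on UNIV g"
  shows "conv_in_distr M (\<lambda>n \<omega>. g (Y n \<omega>)) N (\<lambda>\<omega>. g (Y0 \<omega>))"
  unfolding conv_in_distr_def
proof (intro allI impI)
  fix f :: "'d \<Rightarrow> real"
  assume f: "continuous_on UNIV f \<and> bounded (range f)"
  then have "continuous_on UNIV (\<lambda>y. f (g y))"
    by (intro continuous_on_compose2[OF _ g]) auto
  moreover have "bounded (range (\<lambda>y. f (g y)))"
    by (rule bounded_subset[of "range f"]) (use f in auto)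
  ultimately show "(\<lambda>n. \<integral>\<omega>. f (g (Y n \<omega>)) \<partial>M) \<longlonglongrightarrow> (\<integral>\<omega>. f (g (Y0 \<omega>)) \<partial>N)"
    using assms(1)[unfolded conv_in_distr_def, rule_format, of "\<lambda>y. f (g y)"] by simp
qed

text \<open>
  Piecewise linear steps determine weak convergence and are uniformly continuous, so the integrals
  over two sequences that are close in probability differ by little.
\<close>

lemma slutsky:
  fixes Y W :: "nat \<Rightarrow> 'a \<Rightarrow> real"
  assumes M: "prob_space M" and N: "prob_space N"
    and Y [measurable]: "\<And>n. Y n \<in> borel_measurable M"
    and W [measurable]: "\<And>n. W n \<in> borel_measurable M"
    and Y0 [measurable]: "Y0 \<in> borel_measurable N"
    and conv: "weak_conv_m (\<lambda>n. distr M borel (Y n)) (distr N borel Y0)"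
    and diff: "conv_zero_in_prob M (\<lambda>n \<omega>. W n \<omega> - Y n \<omega>)"
  shows "weak_conv_m (\<lambda>n. distr M borel (W n)) (distr N borel Y0)"
proof -
  interpret M: prob_space M by fact
  have rd: "real_distribution (distr M borel (Y n))" "real_distribution (distr M borel (W n))"
    "real_distribution (distr N borel Y0)" for n
    using prob_space.real_distribution_distr[OF M] prob_space.real_distribution_distr[OF N] by auto
  show ?thesis
  proof (rule integral_cts_step_conv_imp_weak_conv[OF rd(2,3)])
    fix a b :: real assume ab: "a < b"
    let ?f = "cts_step a b"
    have f_bounds: "0 \<le> ?f x" "?f x \<le> 1" for x
      using ab by (auto simp: cts_step_def field_simps)
    have f_cont: "continuous_on UNIV ?f"
      by (intro uniformly_continuous_imp_continuous cts_step_uniformly_continuous ab)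
    then have [measurable]: "?f \<in> borel_measurable borel"
      by (rule borel_measurable_continuous_onI)
    have intY: "integrable M (\<lambda>\<omega>. ?f (Y n \<omega>))" and intW: "integrable M (\<lambda>\<omega>. ?f (W n \<omega>))" for n
      by (rule M.integrable_const_bound[of _ 1]; use f_bounds in auto)+
    have limY: "(\<lambda>n. \<integral>x. ?f x \<partial>distr M borel (Y n)) \<longlonglongrightarrow> (\<integral>x. ?f x \<partial>distr N borel Y0)"
      by (rule weak_conv_imp_integral_bdd_continuous_conv[OF rd(1,3) conv, of _ 1])
        (use f_cont f_bounds in \<open>auto simp: continuous_on_eq_continuous_at\<close>)
    have "(\<lambda>n. (\<integral>\<omega>. ?f (W n \<omega>) \<partial>M) - (\<integral>\<omega>. ?f (Y n \<omega>) \<partial>M)) \<longlonglongrightarrow> 0"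
    proof (rule LIMSEQ_I)
      fix r :: real assume "r > 0"
      then have "r / 2 > 0" by simp
      then obtain d where "d > 0" and d: "\<And>x y. \<bar>x - y\<bar> < d \<Longrightarrow> \<bar>?f x - ?f y\<bar> < r / 2"
        using cts_step_uniformly_continuous[OF ab, unfolded uniformly_continuous_on_def,
            rule_format, OF \<open>r / 2 > 0\<close>]
        by (auto simp: dist_real_def)
      let ?B = "\<lambda>n. {\<omega> \<in> space M. \<bar>W n \<omega> - Y n \<omega>\<bar> > d / 2}"
      have "(\<lambda>n. measure M (?B n)) \<longlonglongrightarrow> 0"
        by (rule diff[unfolded conv_zero_in_prob_def, rule_format]) (use \<open>d > 0\<close> in simp)
      then have small: "\<forall>\<^sub>F n in sequentially. measure M (?B n) < r / 2"
        using \<open>r / 2 > 0\<close> by (rule order_tendstoD)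
      have bound: "\<bar>(\<integral>\<omega>. ?f (W n \<omega>) \<partial>M) - (\<integral>\<omega>. ?f (Y n \<omega>) \<partial>M)\<bar> \<le> r / 2 + measure M (?B n)" for n
      proof -
        have "\<bar>(\<integral>\<omega>. ?f (W n \<omega>) \<partial>M) - (\<integral>\<omega>. ?f (Y n \<omega>) \<partial>M)\<bar>
            = \<bar>\<integral>\<omega>. ?f (W n \<omega>) - ?f (Y n \<omega>) \<partial>M\<bar>"
          by (simp add: intY intW)
        also have "\<dots> \<le> (\<integral>\<omega>. \<bar>?f (W n \<omega>) - ?f (Y n \<omega>)\<bar> \<partial>M)"
          by (rule integral_abs_bound)
        also have "\<dots> \<le> (\<integral>\<omega>. r / 2 + indicator (?B n) \<omega> \<partial>M)"
        proof (rule integral_mono)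
          fix \<omega> assume \<omega>: "\<omega> \<in> space M"
          show "\<bar>?f (W n \<omega>) - ?f (Y n \<omega>)\<bar> \<le> r / 2 + indicator (?B n) \<omega>"
          proof (cases "\<omega> \<in> ?B n")
            case True
            have "\<bar>?f (W n \<omega>) - ?f (Y n \<omega>)\<bar> \<le> 1"
              using f_bounds[of "W n \<omega>"] f_bounds[of "Y n \<omega>"] by linarith
            then show ?thesis using True \<open>r > 0\<close> by simp
          next
            case False
            then have "\<bar>W n \<omega> - Y n \<omega>\<bar> < d"
              using \<omega> \<open>d > 0\<close> by simp
            from d[OF this] show ?thesis using False by simp
          qed
        qed (auto intro!: intY intW Bochner_Integration.integrable_add integrable_real_indicator
              simp: less_top[symmetric])
        also have "\<dots> = r / 2 + measure M (?B n)"
          by (subst Bochner_Integration.integral_add)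
            (auto simp: M.prob_space less_top[symmetric])
        finally show ?thesis .
      qed
      from small have "\<forall>\<^sub>F n in sequentially.
          norm ((\<integral>\<omega>. ?f (W n \<omega>) \<partial>M) - (\<integral>\<omega>. ?f (Y n \<omega>) \<partial>M) - 0) < r"
      proof eventually_elim
        case (elim n)
        then show ?case using bound[of n] by simp
      qed
      then show "\<exists>n0. \<forall>n\<ge>n0. norm ((\<integral>\<omega>. ?f (W n \<omega>) \<partial>M) - (\<integral>\<omega>. ?f (Y n \<omega>) \<partial>M) - 0) < r"
        by (simp add: eventually_sequentially)
    qed
    from tendsto_add[OF this limY]
    show "(\<lambda>n. \<integral>x. ?f x \<partial>distr M borel (W n)) \<longlonglongrightarrow> (\<integral>x. ?f x \<partial>distr N borel Y0)"
      by (simp add: integral_distr)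
  qed
qed

text \<open>
  Convergence along this filter on pairs \<open>(n, \<omega>)\<close> is convergence as \<open>n\<close> tends to infinity, uniformly
  over \<open>\<omega> \<in> E n\<close>. It lets limit lemmas for arbitrary filters be applied to random sequences.
\<close>

definition uniformly_along :: "(nat \<Rightarrow> 'a set) \<Rightarrow> (nat \<times> 'a) filter" where
  "uniformly_along E = inf (filtercomap fst sequentially) (principal {(n, \<omega>). \<omega> \<in> E n})"

lemma eventually_uniformly_along:
  "eventually P (uniformly_along E) \<longleftrightarrow> (\<exists>n0. \<forall>n\<ge>n0. \<forall>\<omega>\<in>E n. P (n, \<omega>))"
  unfolding uniformly_along_def eventually_inf_principal
    eventually_filtercomap_at_top_linorder by auto

lemma filterlim_fst_uniformly_along: "filterlim fst sequentially (uniformly_along E)"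
  unfolding uniformly_along_def
  by (rule filterlim_mono[OF filterlim_filtercomap]) auto

text \<open>
  Uniform convergence on events of probability arbitrarily close to 1 implies convergence in
  probability. The exceptional sets \<open>space M - E n\<close> eventually contain the
  sets on which \<open>\<bar>R n\<bar>\<close> exceeds a given level.
\<close>

lemma conv_zero_in_prob_uniformly_along:
  assumes M: "prob_space M"
    and E: "\<And>\<eta>. \<eta> > 0 \<Longrightarrow> \<exists>E. (\<forall>\<^sub>F n in sequentially. E n \<in> sets M \<and> measure M (space M - E n) < \<eta>) \<and>
              ((\<lambda>(n, \<omega>). R n \<omega>) \<longlongrightarrow> 0) (uniformly_along E)"
  shows "conv_zero_in_prob M R"
  unfolding conv_zero_in_prob_def
proof (intro allI impI)
  interpret prob_space M by fact
  fix \<epsilon> :: real assume "\<epsilon> > 0"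
  show "(\<lambda>n. measure M {\<omega> \<in> space M. \<bar>R n \<omega>\<bar> > \<epsilon>}) \<longlonglongrightarrow> 0"
  proof (rule order_tendstoI)
    fix \<eta> :: real assume "\<eta> > 0"
    then obtain E where E: "\<forall>\<^sub>F n in sequentially. E n \<in> sets M \<and> measure M (space M - E n) < \<eta>"
      and lim: "((\<lambda>(n, \<omega>). R n \<omega>) \<longlongrightarrow> 0) (uniformly_along E)"
      using E by blast
    have "\<forall>\<^sub>F i in uniformly_along E. \<bar>case i of (n, \<omega>) \<Rightarrow> R n \<omega>\<bar> < \<epsilon>"
      using tendstoD[OF lim \<open>\<epsilon> > 0\<close>] by (simp add: dist_real_def)
    then have "\<forall>\<^sub>F n in sequentially. \<forall>\<omega>\<in>E n. \<bar>R n \<omega>\<bar> < \<epsilon>"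
      by (simp add: eventually_uniformly_along eventually_sequentially)
    with E show "\<forall>\<^sub>F n in sequentially. measure M {\<omega> \<in> space M. \<bar>R n \<omega>\<bar> > \<epsilon>} < \<eta>"
    proof eventually_elim
      case (elim n)
      then have "measure M {\<omega> \<in> space M. \<bar>R n \<omega>\<bar> > \<epsilon>} \<le> measure M (space M - E n)"
        by (intro finite_measure_mono) (auto dest!: bspec)
      then show ?case using elim by simp
    qed
  qed (simp add: less_le_trans)
qed

section \<open>Asymptotic distribution of the tail probability estimator\<close>

theorem theorem5p2:
  fixes \<gamma> \<tau> lam :: real
    and F :: "real \<Rightarrow> real"
    and M :: "'a measure" and X :: "nat \<Rightarrow> 'a \<Rightarrow> real"
    and k :: "nat \<Rightarrow> nat" and x p :: "nat \<Rightarrow> real"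
    and \<gamma>hat \<delta>hat \<tau>hat phat :: "nat \<Rightarrow> 'a \<Rightarrow> real"
    and N :: "'b measure" and G D Z :: "'b \<Rightarrow> real"
  defines "Xk \<equiv> \<lambda>n \<omega>. order_statistic (\<lambda>i. X i \<omega>) (n - k n) n"
  assumes "\<gamma> > 0" and "\<tau> < 0"
    and "F \<in> tail_class \<gamma> \<tau>" and "F 0 = 0"
    and "prob_space M"
    and "prob_space.indep_vars M (\<lambda>_. borel) X UNIV"
    and "\<And>i. cdf (distr M borel (X i)) = F"
    and "\<And>n. n \<ge> 2 \<Longrightarrow> k n \<in> {1..n - 1}"
    and "filterlim k at_top sequentially"
    and "(\<lambda>n. real (k n) / real n) \<longlonglongrightarrow> 0"
    and "(\<lambda>n. sqrt (real (k n)) * tail_a \<gamma> F (real n / real (k n))) \<longlonglongrightarrow> lam"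
    and "filterlim x at_top sequentially"
    and "\<And>n. p n = 1 - F (x n)"
    and "(\<lambda>n. real n * p n / real (k n)) \<longlonglongrightarrow> 0"
    and "(\<lambda>n. ln (real n * p n) / sqrt (real (k n))) \<longlonglongrightarrow> 0"
    and "\<And>n. \<gamma>hat n \<in> borel_measurable M"
    and "\<And>n. \<delta>hat n \<in> borel_measurable M"
    and "\<And>n. \<tau>hat n \<in> borel_measurable M"
    and "conv_zero_in_prob M (\<lambda>n \<omega>. \<tau>hat n \<omega> - \<tau>)"
    and "prob_space N"
    and "G \<in> borel_measurable N" and "D \<in> borel_measurable N" and "Z \<in> borel_measurable N"
    and "conv_in_distr M
           (\<lambda>n \<omega>. (sqrt (real (k n)) * (\<gamma>hat n \<omega> - \<gamma>),
                   sqrt (real (k n)) * (\<delta>hat n \<omega> - tail_delta \<gamma> F (Xk n \<omega>)),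
                   sqrt (real (k n)) * (real n * (1 - F (Xk n \<omega>)) / real (k n) - 1)))
           N (\<lambda>\<omega>. (G \<omega>, D \<omega>, Z \<omega>))"
    and "\<And>n. phat n \<in> borel_measurable M"
    and "\<And>n \<omega>. n \<ge> 2 \<Longrightarrow> \<omega> \<in> space M \<Longrightarrow> epd_params (\<gamma>hat n \<omega>) (\<delta>hat n \<omega>) (\<tau>hat n \<omega>) \<Longrightarrow>
           phat n \<omega> = real (k n) / real n *
             (1 - epd_cdf (\<gamma>hat n \<omega>) (\<delta>hat n \<omega>) (\<tau>hat n \<omega>) (x n / Xk n \<omega>))"
  shows "weak_conv_m
           (\<lambda>n. distr M borel (\<lambda>\<omega>. sqrt (real (k n)) / ln (real (k n) / (real n * p n)) *
                                    (phat n \<omega> / p n - 1)))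
           (distr N borel (\<lambda>\<omega>. G \<omega> / \<gamma>))"
proof -
  interpret M: prob_space M by fact
  note [measurable] = \<open>\<And>n. \<gamma>hat n \<in> borel_measurable M\<close> \<open>\<And>n. \<delta>hat n \<in> borel_measurable M\<close>
    \<open>\<And>n. \<tau>hat n \<in> borel_measurable M\<close> \<open>\<And>n. phat n \<in> borel_measurable M\<close>
    \<open>G \<in> borel_measurable N\<close> \<open>D \<in> borel_measurable N\<close> \<open>Z \<in> borel_measurable N\<close>
  note p_eq = \<open>\<And>n. p n = 1 - F (x n)\<close>
  note phat_eq = assms(27)
  note k_range = \<open>\<And>n. n \<ge> 2 \<Longrightarrow> k n \<in> {1..n - 1}\<close>
  note F = \<open>F \<in> tail_class \<gamma> \<tau>\<close>
  have [measurable]: "F \<in> borel_measurable borel"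
    by (rule borel_measurable_mono[OF tail_class_cdf(1)[OF F]])
  have [measurable]: "tail_delta \<gamma> F \<in> borel_measurable borel"
    unfolding tail_delta_def[abs_def] by measurable
  have "X i \<in> borel_measurable M" for i
    using \<open>M.indep_vars (\<lambda>_. borel) X UNIV\<close> unfolding M.indep_vars_def by blast
  then have Xk: "Xk n \<in> borel_measurable M" if "n \<ge> 2" for n
  proof -
    have "1 \<le> n - k n" "n - k n \<le> n"
      using k_range[OF that] that by auto
    then show ?thesis
      unfolding Xk_def using \<open>\<And>i. X i \<in> borel_measurable M\<close>
      by (intro borel_measurable_order_statistic)
  qed
  define s where "s n = sqrt (real (k n))" for n
  define m where "m n = real n / real (k n)" for n
  define V where "V n \<omega> = (s n * (\<gamma>hat n \<omega> - \<gamma>), s n * (\<delta>hat n \<omega> - tail_delta \<gamma> F (Xk n \<omega>)),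
    s n * (m n * (1 - F (Xk n \<omega>)) - 1))" for n \<omega>
  have conv_V: "conv_in_distr M V N (\<lambda>\<omega>. (G \<omega>, D \<omega>, Z \<omega>))"
    using \<open>conv_in_distr _ _ _ _\<close> by (simp add: V_def[abs_def] s_def m_def)
  have V_meas: "V n \<in> borel_measurable M" if "n \<ge> 2" for n
    using Xk[OF that, measurable] unfolding V_def[abs_def] by measurable
  have k_pos: "\<forall>\<^sub>F n in sequentially. k n > 0"
    using eventually_ge_at_top[of 2]
    by eventually_elim (use k_range in \<open>simp add: Suc_le_eq\<close>)
  have k_real: "filterlim (\<lambda>n. real (k n)) at_top sequentially"
    by (rule filterlim_compose[OF filterlim_real_sequentially \<open>filterlim k at_top sequentially\<close>])
  have s_lim: "filterlim s at_top sequentially"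
    unfolding s_def[abs_def] by (rule filterlim_compose[OF sqrt_at_top k_real])
  have m_lim: "filterlim m at_top sequentially"
  proof -
    have "filterlim (\<lambda>n. inverse (real (k n) / real n)) at_top sequentially"
      using \<open>(\<lambda>n. real (k n) / real n) \<longlonglongrightarrow> 0\<close>
      by (rule filterlim_inverse_at_top)
        (use k_pos eventually_gt_at_top[of 0] in eventually_elim, simp)
    then show ?thesis by (simp add: m_def[abs_def])
  qed
  have p_pos: "p n > 0" for n
    using tail_class_less_1[OF F] by (simp add: p_eq)
  have mp_lim: "(\<lambda>n. m n * (1 - F (x n))) \<longlonglongrightarrow> 0"
    using \<open>(\<lambda>n. real n * p n / real (k n)) \<longlonglongrightarrow> 0\<close> by (simp add: m_def p_eq)
  have ln_mp: "(\<lambda>n. ln (m n * (1 - F (x n))) / s n) \<longlonglongrightarrow> 0"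
  proof -
    \<comment> \<open>The hypothesis bounds \<open>ln (n p)\<close>; the missing \<open>ln k\<close> is negligible against \<open>sqrt k\<close>.\<close>
    have "(\<lambda>n. ln (real (k n)) / real (k n) powr (1/2)) \<longlonglongrightarrow> 0"
      using lim_ln_over_power[of "1/2"] by (intro filterlim_compose[OF _ \<open>filterlim k at_top sequentially\<close>]) simp
    then have "(\<lambda>n. ln (real n * p n) / s n - ln (real (k n)) / s n) \<longlonglongrightarrow> 0 - 0"
      unfolding s_def
      by (intro tendsto_diff \<open>(\<lambda>n. ln (real n * p n) / sqrt (real (k n))) \<longlonglongrightarrow> 0\<close>)
        (simp add: powr_half_sqrt)
    then have "(\<lambda>n. ln (real n * p n) / s n - ln (real (k n)) / s n) \<longlonglongrightarrow> 0"
      by simp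
    then show ?thesis
    proof (rule Lim_transform_eventually)
      show "\<forall>\<^sub>F n in sequentially. ln (real n * p n) / s n - ln (real (k n)) / s n =
          ln (m n * (1 - F (x n))) / s n"
        using k_pos eventually_gt_at_top[of 0]
      proof eventually_elim
        case (elim n)
        have "m n * (1 - F (x n)) = real n * p n / real (k n)"
          by (simp add: m_def p_eq)
        then show ?case
          using elim p_pos[of n] by (simp add: ln_div diff_divide_distrib)
      qed
    qed
  qed
  define W where "W n \<omega> = sqrt (real (k n)) / ln (real (k n) / (real n * p n)) * (phat n \<omega> / p n - 1)" for n \<omega>
  have diff: "conv_zero_in_prob M (\<lambda>n \<omega>. W n \<omega> - s n * (\<gamma>hat n \<omega> - \<gamma>) / \<gamma>)"
  proof (rule conv_zero_in_prob_uniformly_along[OF \<open>prob_space M\<close>])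
    fix \<eta> :: real assume "\<eta> > 0"
    then have "\<eta> / 2 > 0" by simp
    have "(\<lambda>\<omega>. (G \<omega>, D \<omega>, Z \<omega>)) \<in> borel_measurable N"
      by measurable
    from conv_in_distr_imp_tight[OF \<open>prob_space M\<close> \<open>prob_space N\<close>
        eventually_sequentiallyI[of 2 "\<lambda>n. V n \<in> borel_measurable M", OF V_meas] this
        conv_V \<open>\<eta> / 2 > 0\<close>]
    obtain K where K: "\<forall>\<^sub>F n in sequentially. measure M {\<omega> \<in> space M. norm (V n \<omega>) > K} < \<eta> / 2"
      by blast
    have "(\<lambda>n. measure M {\<omega> \<in> space M. \<bar>\<tau>hat n \<omega> - \<tau>\<bar> > - \<tau> / 2}) \<longlonglongrightarrow> 0"
      by (rule \<open>conv_zero_in_prob _ _\<close>[unfolded conv_zero_in_prob_def, rule_format])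
        (use \<open>\<tau> < 0\<close> in simp)
    then have T: "\<forall>\<^sub>F n in sequentially. measure M {\<omega> \<in> space M. \<bar>\<tau>hat n \<omega> - \<tau>\<bar> > - \<tau> / 2} < \<eta> / 2"
      using \<open>\<eta> / 2 > 0\<close> by (rule order_tendstoD)
    \<comment> \<open>On \<open>E n\<close> the hypotheses of the deterministic expansion hold with constants free of \<open>n\<close> and \<open>\<omega>\<close>.\<close>
    define E where "E n = {\<omega> \<in> space M. norm (V n \<omega>) \<le> K \<and> \<bar>\<tau>hat n \<omega> - \<tau>\<bar> \<le> - \<tau> / 2}" for n
    have "\<forall>\<^sub>F n in sequentially. E n \<in> sets M \<and> measure M (space M - E n) < \<eta>"
      using K T eventually_ge_at_top[of 2]
    proof eventually_elim
      case (elim n)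
      note [measurable] = V_meas[OF elim(3)]
      have "measure M (space M - E n) \<le> measure M ({\<omega> \<in> space M. norm (V n \<omega>) > K}
          \<union> {\<omega> \<in> space M. \<bar>\<tau>hat n \<omega> - \<tau>\<bar> > - \<tau> / 2})"
        by (intro M.finite_measure_mono) (auto simp: E_def)
      also have "\<dots> \<le> measure M {\<omega> \<in> space M. norm (V n \<omega>) > K}
          + measure M {\<omega> \<in> space M. \<bar>\<tau>hat n \<omega> - \<tau>\<bar> > - \<tau> / 2}"
        by (rule measure_Un_le) auto
      finally have "measure M (space M - E n) < \<eta>"
        using elim by simp
      moreover have "E n \<in> sets M"
        unfolding E_def by measurable
      ultimately show ?case by simp
    qed
    moreover have "((\<lambda>(n, \<omega>). W n \<omega> - s n * (\<gamma>hat n \<omega> - \<gamma>) / \<gamma>) \<longlongrightarrow> 0) (uniformly_along E)"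
    proof -
      let ?L = "uniformly_along E"
      note along = filterlim_compose[OF _ filterlim_fst_uniformly_along[of E]]
      have on_E: "\<forall>\<^sub>F i in ?L. P i" if "\<And>n \<omega>. n \<ge> 2 \<Longrightarrow> \<omega> \<in> E n \<Longrightarrow> P (n, \<omega>)" for P
        using that by (auto simp: eventually_uniformly_along)
      have comp: "\<bar>a\<bar> \<le> norm (a, b, c)" "\<bar>b\<bar> \<le> norm (a, b, c)" "\<bar>c\<bar> \<le> norm (a, b, c)"
        for a b c :: real
        using norm_fst_le[of a "(b, c)"] norm_snd_le[of "(b, c)" a]
          norm_fst_le[of b c] norm_snd_le[of c b] by auto
      have V_le: "\<bar>s n * (\<gamma>hat n \<omega> - \<gamma>)\<bar> \<le> K"
        "\<bar>s n * (\<delta>hat n \<omega> - tail_delta \<gamma> F (Xk n \<omega>))\<bar> \<le> K"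
        "\<bar>s n * (m n * (1 - F (Xk n \<omega>)) - 1)\<bar> \<le> K" if "\<omega> \<in> E n" for n \<omega>
      proof -
        have le: "norm (s n * (\<gamma>hat n \<omega> - \<gamma>), s n * (\<delta>hat n \<omega> - tail_delta \<gamma> F (Xk n \<omega>)),
            s n * (m n * (1 - F (Xk n \<omega>)) - 1)) \<le> K"
          using that unfolding E_def V_def by blast
        show "\<bar>s n * (\<gamma>hat n \<omega> - \<gamma>)\<bar> \<le> K"
          by (rule order.trans[OF comp(1) le])
        show "\<bar>s n * (\<delta>hat n \<omega> - tail_delta \<gamma> F (Xk n \<omega>))\<bar> \<le> K"
          by (rule order.trans[OF comp(2) le])
        show "\<bar>s n * (m n * (1 - F (Xk n \<omega>)) - 1)\<bar> \<le> K"
          by (rule order.trans[OF comp(3) le])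
      qed
      have "((\<lambda>i. s (fst i) / ln (1 / (m (fst i) * (1 - F (x (fst i)))))
            * (phat (fst i) (snd i) / (1 - F (x (fst i))) - 1)
          - s (fst i) * (\<gamma>hat (fst i) (snd i) - \<gamma>) / \<gamma>) \<longlongrightarrow> 0) ?L"
      proof (rule epd_relative_error_expansion[OF F \<open>\<gamma> > 0\<close> \<open>\<tau> < 0\<close> \<open>F 0 = 0\<close>
            along[OF m_lim] along[OF s_lim] _ along[OF \<open>filterlim x at_top sequentially\<close>]
            along[OF mp_lim] along[OF ln_mp]])
        show "((\<lambda>i. s (fst i) * tail_a \<gamma> F (m (fst i))) \<longlongrightarrow> lam) ?L"
          unfolding s_def m_def by (rule along) fact
        show "\<forall>\<^sub>F i in ?L. \<bar>s (fst i) * (\<gamma>hat (fst i) (snd i) - \<gamma>)\<bar> \<le> K"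
          by (rule on_E) (simp add: V_le)
        show "\<forall>\<^sub>F i in ?L. \<bar>s (fst i) * (\<delta>hat (fst i) (snd i)
            - tail_delta \<gamma> F (Xk (fst i) (snd i)))\<bar> \<le> K"
          by (rule on_E) (simp add: V_le)
        show "\<forall>\<^sub>F i in ?L. \<bar>s (fst i) * (m (fst i) * (1 - F (Xk (fst i) (snd i))) - 1)\<bar> \<le> K"
          by (rule on_E) (simp add: V_le)
        show "\<forall>\<^sub>F i in ?L. \<bar>\<tau>hat (fst i) (snd i) - \<tau>\<bar> \<le> - \<tau> / 2"
          by (rule on_E) (simp add: E_def)
        show "\<forall>\<^sub>F i in ?L. epd_params (\<gamma>hat (fst i) (snd i)) (\<delta>hat (fst i) (snd i)) (\<tau>hat (fst i) (snd i))
            \<longrightarrow> phat (fst i) (snd i) = 1 / m (fst i) * (1 - epd_cdf (\<gamma>hat (fst i) (snd i))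
              (\<delta>hat (fst i) (snd i)) (\<tau>hat (fst i) (snd i)) (x (fst i) / Xk (fst i) (snd i)))"
        proof (rule on_E, rule impI)
          fix n \<omega>
          assume n: "n \<ge> 2" "\<omega> \<in> E n" and "epd_params (\<gamma>hat (fst (n, \<omega>)) (snd (n, \<omega>)))
            (\<delta>hat (fst (n, \<omega>)) (snd (n, \<omega>))) (\<tau>hat (fst (n, \<omega>)) (snd (n, \<omega>)))"
          then show "phat (fst (n, \<omega>)) (snd (n, \<omega>)) = 1 / m (fst (n, \<omega>)) *
              (1 - epd_cdf (\<gamma>hat (fst (n, \<omega>)) (snd (n, \<omega>))) (\<delta>hat (fst (n, \<omega>)) (snd (n, \<omega>)))
              (\<tau>hat (fst (n, \<omega>)) (snd (n, \<omega>))) (x (fst (n, \<omega>)) / Xk (fst (n, \<omega>)) (snd (n, \<omega>))))"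
            using phat_eq[of n \<omega>] by (simp add: m_def E_def)
        qed
      qed
      then show ?thesis
        by (simp add: W_def s_def m_def p_eq case_prod_unfold)
    qed
    ultimately show "\<exists>E. (\<forall>\<^sub>F n in sequentially. E n \<in> sets M \<and> measure M (space M - E n) < \<eta>) \<and>
        ((\<lambda>(n, \<omega>). W n \<omega> - s n * (\<gamma>hat n \<omega> - \<gamma>) / \<gamma>) \<longlongrightarrow> 0) (uniformly_along E)"
      by (intro exI[of _ E] conjI)
  qed
  have conv_G: "weak_conv_m (\<lambda>n. distr M borel (\<lambda>\<omega>. s n * (\<gamma>hat n \<omega> - \<gamma>) / \<gamma>))
      (distr N borel (\<lambda>\<omega>. G \<omega> / \<gamma>))"
  proof (rule conv_in_distr_iff_weak_conv_m[THEN iffD1, OF \<open>prob_space M\<close> \<open>prob_space N\<close>])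
    have "continuous_on UNIV (\<lambda>v :: real \<times> real \<times> real. fst v / \<gamma>)"
      using \<open>\<gamma> > 0\<close> by (intro continuous_intros) auto
    from conv_in_distr_compose[OF conv_V this]
    show "conv_in_distr M (\<lambda>n \<omega>. s n * (\<gamma>hat n \<omega> - \<gamma>) / \<gamma>) N (\<lambda>\<omega>. G \<omega> / \<gamma>)"
      by (simp add: V_def)
  qed measurable
  have "weak_conv_m (\<lambda>n. distr M borel (W n)) (distr N borel (\<lambda>\<omega>. G \<omega> / \<gamma>))"
    by (rule slutsky[OF \<open>prob_space M\<close> \<open>prob_space N\<close> _ _ _ conv_G diff])
      (unfold W_def[abs_def], measurable)
  then show ?thesis
    by (simp add: W_def[abs_def])
qed

end
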